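(* Let $\Omega$ be a finite alphabet with $b\ge 2$ symbols. Every Martin-Löf random element of $\Omega^{\mathbb N}$ is Poisson generic.
   Context: $\mathbb N=\{1,2,\dots\}$ and $\mathbb N_0=\{0,1,2,\dots\}$. $\Omega^k$ is the set of words of length $k$ over $\Omega$, $\Omega^{<\mathbb N}=\bigcup_{k\ge1}\Omega^k$, and $\Omega^{\mathbb N}$ is the set of infinite sequences of symbols of $\Omega$. Positions in words and sequences are numbered starting from $1$; $x[j,j+k)$ denotes the block of $x$ occupying positions $j,j+1,\dots,j+k-1$. Poisson genericity. For $j,k\in\mathbb N$, $x\in\Omega^{\mathbb N}$ and $\omega\in\Omega^k$, let $I_j(x,\omega)=1$ if $x[j,j+k)=\omega$ and $I_j(x,\omega)=0$ otherwise. For a positive real $\lambda$, $k\in\mathbb N$ and $i\in\mathbb N_0$ let $$Z^\lambda_{i,k}(x)=\frac{1}{b^k}\,\#\Big\{\omega\in\Omega^k:\ \sum_{1\le j\le \lambda b^k} I_j(x,\omega)=i\Big\}.$$ An element $x\in\Omega^{\mathbb N}$ is $\lambda$-Poisson generic if for every $i\in\mathbb N_0$, $\lim_{k\to\infty}Z^\lambda_{i,k}(x)=e^{-\lambda}\lambda^i/i!$. It is Poisson generic if it is $\lambda$-Poisson generic for all positive real numbers $\lambda$. Martin-Löf randomness. Let $\mu$ be the uniform probability measure on $\Omega$ and $\mu^{\mathbb N}$ the product measure on $\Omega^{\mathbb N}$. For $\omega\in\Omega^{<\mathbb N}$ let $B_\omega=\{\omega z: z\in\Omega^{\mathbb N}\}$,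 so that $\mu^{\mathbb N}(B_\omega)=b^{-|\omega|}$, where $|\omega|$ is the length of $\omega$. A sequence $(O_n)_{n\ge1}$ of open subsets of $\Omega^{\mathbb N}$ is uniformly computable if there is a computable function $f:\mathbb N\times\mathbb N\to\Omega^{<\mathbb N}$ such that $O_n=\bigcup_{i\ge1}B_{f(n,i)}$ for each $n\in\mathbb N$. A Martin-Löf test is a uniformly computable sequence $(O_n)_{n\ge1}$ of open sets whose measure is computably bounded and goes to $0$ as $n\to\infty$, meaning that there is a computable sequence $(r_n)_{n\ge1}$ of rationals with $r_n\to0$ and $\mu^{\mathbb N}(O_n)\le r_n$ for all $n$. A sequence $x\in\Omega^{\mathbb N}$ is Martin-Löf random if, for every Martin-Löf test $(O_n)_{n\ge1}$, $x\notin\bigcap_{n\ge1}O_n$. *)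

theory Defs
  imports "HOL-Probability.Probability" "HOL-Library.Nat_Bijection"
begin

text \<open>
  The alphabet is the universe of a finite type. An infinite sequence is a function on
  \<^typ>\<open>nat\<close>, and the symbol at position \<open>p \<ge> 1\<close> of \<open>x\<close> is \<open>x (p - 1)\<close>.
\<close>

definition block :: "(nat \<Rightarrow> 'a) \<Rightarrow> nat \<Rightarrow> nat \<Rightarrow> 'a list" where
  "block x j k = map (\<lambda>p. x (p - 1)) [j..<j + k]"

definition occurs_at :: "nat \<Rightarrow> (nat \<Rightarrow> 'a) \<Rightarrow> 'a list \<Rightarrow> nat" where
  "occurs_at j x w = (if block x j (length w) = w then 1 else 0)"

definition Z :: "real \<Rightarrow> nat \<Rightarrow> nat \<Rightarrow> (nat \<Rightarrow> 'a::finite) \<Rightarrow> real" where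
  "Z lam i k x =
     1 / real (CARD('a) ^ k) *
     real (card {w :: 'a list. length w = k \<and>
       (\<Sum>j | 1 \<le> j \<and> real j \<le> lam * real (CARD('a) ^ k). occurs_at j x w) = i})"

definition poisson_generic_for :: "real \<Rightarrow> (nat \<Rightarrow> 'a::finite) \<Rightarrow> bool" where
  "poisson_generic_for lam x \<longleftrightarrow>
     (\<forall>i. (\<lambda>k. Z lam i k x) \<longlonglongrightarrow> exp (- lam) * lam ^ i / fact i)"

definition poisson_generic :: "(nat \<Rightarrow> 'a::finite) \<Rightarrow> bool" where
  "poisson_generic x \<longleftrightarrow> (\<forall>lam>0. poisson_generic_for lam x)"

text \<open>
  The general recursive functions of each arity: the least class containing the basic functions
  and closed under composition, primitive recursion and minimization of regular functions.
  A function of arity \<open>n\<close> is given by its values on lists of length \<open>n\<close>; its values on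
  other lists are irrelevant.
\<close>

inductive recursive :: "nat \<Rightarrow> (nat list \<Rightarrow> nat) \<Rightarrow> bool" where
  zero: "recursive n (\<lambda>xs. 0)"
| succ: "recursive 1 (\<lambda>xs. Suc (xs ! 0))"
| proj: "i < n \<Longrightarrow> recursive n (\<lambda>xs. xs ! i)"
| comp: "recursive (length gs) f \<Longrightarrow> \<forall>g\<in>set gs. recursive n g \<Longrightarrow>
    recursive n (\<lambda>xs. f (map (\<lambda>g. g xs) gs))"
| prim_rec: "recursive n f \<Longrightarrow> recursive (n + 2) g \<Longrightarrow>
    recursive (Suc n) (\<lambda>xs. rec_nat (f (tl xs)) (\<lambda>k r. g (k # r # tl xs)) (hd xs))"
| minimize: "recursive (Suc n) f \<Longrightarrow> (\<And>xs. length xs = n \<Longrightarrow> \<exists>y. f (y # xs) = 0) \<Longrightarrow>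
    recursive n (\<lambda>xs. LEAST y. f (y # xs) = 0)"

definition computable1 :: "(nat \<Rightarrow> nat) \<Rightarrow> bool" where
  "computable1 f \<longleftrightarrow> (\<exists>F. recursive 1 F \<and> (\<forall>m. f m = F [m]))"

definition computable2 :: "(nat \<Rightarrow> nat \<Rightarrow> nat) \<Rightarrow> bool" where
  "computable2 f \<longleftrightarrow> (\<exists>F. recursive 2 F \<and> (\<forall>m n. f m n = F [m, n]))"

text \<open>
  Since the alphabet is finite, \<^term>\<open>to_nat_on UNIV\<close> is a bijection from it onto
  \<open>{0, \<dots>, b - 1}\<close>; any other such bijection yields the same computable functions.
  Words are coded by applying \<^const>\<open>list_encode\<close> to the list of symbol numbers
  (the arbitrary injection \<^const>\<open>to_nat\<close> on lists would not do, as it need not be effective).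
\<close>

definition word_code :: "'a::finite list \<Rightarrow> nat" where
  "word_code w = list_encode (map (to_nat_on (UNIV :: 'a set)) w)"

definition computable_word_fun :: "(nat \<Rightarrow> nat \<Rightarrow> 'a::finite list) \<Rightarrow> bool" where
  "computable_word_fun f \<longleftrightarrow> computable2 (\<lambda>m n. word_code (f m n))"

definition computable_rat_seq :: "(nat \<Rightarrow> rat) \<Rightarrow> bool" where
  "computable_rat_seq r \<longleftrightarrow>
     (\<exists>s p q. computable1 s \<and> computable1 p \<and> computable1 q \<and>
       (\<forall>n. q n \<noteq> 0 \<and> r n = (- 1) ^ s n * of_nat (p n) / of_nat (q n)))"

definition uniform_seq_measure :: "(nat \<Rightarrow> 'a::finite) measure" where
  "uniform_seq_measure = (\<Pi>\<^sub>M i\<in>UNIV. uniform_count_measure UNIV)"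

definition cylinder :: "'a list \<Rightarrow> (nat \<Rightarrow> 'a) set" where
  "cylinder w = {(\<lambda>i. if i < length w then w ! i else z (i - length w)) | z. True}"

text \<open>
  Sequences indexed by the positive integers are functions on \<^typ>\<open>nat\<close> whose value at
  \<open>0\<close> is ignored. The sets of a uniformly computable sequence are unions of cylinders, hence
  open in the product topology; see \<open>uniformly_computable_open\<close>.
\<close>

definition uniformly_computable :: "(nat \<Rightarrow> (nat \<Rightarrow> 'a::finite) set) \<Rightarrow> bool" where
  "uniformly_computable U \<longleftrightarrow>
     (\<exists>f. computable_word_fun f \<and> (\<forall>n\<ge>1. \<forall>i\<ge>1. f n i \<noteq> []) \<and>
       (\<forall>n\<ge>1. U n = (\<Union>i\<in>{1..}. cylinder (f n i))))"

definition martin_loef_test :: "(nat \<Rightarrow> (nat \<Rightarrow> 'a::finite) set) \<Rightarrow> bool" where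
  "martin_loef_test U \<longleftrightarrow>
     uniformly_computable U \<and>
     (\<exists>r. computable_rat_seq r \<and> (\<lambda>n. real_of_rat (r n)) \<longlonglongrightarrow> 0 \<and>
       (\<forall>n\<ge>1. measure uniform_seq_measure (U n) \<le> real_of_rat (r n)))"

definition martin_loef_random :: "(nat \<Rightarrow> 'a::finite) \<Rightarrow> bool" where
  "martin_loef_random x \<longleftrightarrow> (\<forall>U. martin_loef_test U \<longrightarrow> x \<notin> (\<Inter>n\<in>{1..}. U n))"

lemma cylinder_altdef: "cylinder w = {x. \<forall>i<length w. x i = w ! i}"
proof (intro equalityI subsetI)
  fix x :: "nat \<Rightarrow> 'a" assume x: "x \<in> {x. \<forall>i<length w. x i = w ! i}"
  have "x = (\<lambda>i. if i < length w then w ! i else (\<lambda>j. x (j + length w)) (i - length w))"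
    by (rule ext) (use x in simp)
  then show "x \<in> cylinder w"
    unfolding cylinder_def mem_Collect_eq by (intro exI conjI TrueI)
next
  fix x :: "nat \<Rightarrow> 'a" assume "x \<in> cylinder w"
  then obtain z where "x = (\<lambda>i. if i < length w then w ! i else z (i - length w))"
    unfolding cylinder_def by blast
  then show "x \<in> {x. \<forall>i<length w. x i = w ! i}"
    by simp
qed

lemma measure_cylinder:
  fixes w :: "'a::finite list"
  shows "measure uniform_seq_measure (cylinder w) = 1 / real CARD('a) ^ length w"
proof -
  let ?M = "uniform_count_measure (UNIV :: 'a set)"
  have M: "prob_space ?M"
    by (rule prob_space_uniform_count_measure) auto
  interpret P: product_prob_space "\<lambda>_::nat. ?M" UNIV
    by (rule product_prob_spaceI) (rule M)
  have "prod_emb UNIV (\<lambda>_. ?M) {..<length w} (\<Pi>\<^sub>E i\<in>{..<length w}. {w ! i}) =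
      {x. \<forall>i<length w. x i = w ! i}"
  proof (rule set_eqI)
    fix x :: "nat \<Rightarrow> 'a"
    have "restrict x {..<length w} \<in> (\<Pi>\<^sub>E i\<in>{..<length w}. {w ! i}) \<longleftrightarrow>
        (\<forall>i<length w. x i = w ! i)"
      unfolding restrict_PiE_iff by blast
    then show "x \<in> prod_emb UNIV (\<lambda>_. ?M) {..<length w} (\<Pi>\<^sub>E i\<in>{..<length w}. {w ! i}) \<longleftrightarrow>
        x \<in> {x. \<forall>i<length w. x i = w ! i}"
      unfolding prod_emb_iff space_uniform_count_measure mem_Collect_eq extensional_UNIV by blast
  qed
  then have "measure uniform_seq_measure (cylinder w) =
      measure (\<Pi>\<^sub>M i\<in>UNIV. ?M) (prod_emb UNIV (\<lambda>_. ?M) {..<length w} (\<Pi>\<^sub>E i\<in>{..<length w}. {w ! i}))"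
    by (simp only: uniform_seq_measure_def cylinder_altdef)
  also have "\<dots> = (\<Prod>i<length w. measure ?M {w ! i})"
    by (rule P.measure_PiM_emb) (simp_all add: sets_uniform_count_measure)
  also have "\<dots> = (\<Prod>i<length w. 1 / real CARD('a))"
    by (simp add: measure_uniform_count_measure)
  also have "\<dots> = 1 / real CARD('a) ^ length w"
    by (simp add: power_one_over)
  finally show ?thesis .
qed

lemma openin_cylinder:
  "openin (product_topology (\<lambda>_. discrete_topology UNIV) UNIV) (cylinder w)"
proof -
  let ?X = "\<lambda>i. if i < length w then {w ! i} else UNIV"
  have "finite {i. ?X i \<noteq> topspace (discrete_topology UNIV)}"
    by (rule finite_subset[of _ "{..<length w}"]) auto
  then have "openin (product_topology (\<lambda>_. discrete_topology UNIV) UNIV) (\<Pi>\<^sub>E i\<in>UNIV. ?X i)"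
    by (intro product_topology_basis) simp_all
  also have "(\<Pi>\<^sub>E i\<in>UNIV. ?X i) = cylinder w"
    unfolding cylinder_altdef PiE_UNIV_domain Pi_def by (auto split: if_splits)
  finally show ?thesis .
qed

lemma uniformly_computable_open:
  assumes "uniformly_computable U" "n \<ge> 1"
  shows "openin (product_topology (\<lambda>_. discrete_topology UNIV) UNIV) (U n)"
proof -
  from assms(1) obtain f where "\<forall>n\<ge>1. U n = (\<Union>i\<in>{1..}. cylinder (f n (i::nat)))"
    unfolding uniformly_computable_def by (elim exE conjE)
  then have U: "U n = (\<Union>i\<in>{1..}. cylinder (f n i))"
    using assms(2) by simp
  show ?thesis
    unfolding U by (rule openin_Union) (auto intro: openin_cylinder)
qed

end

theory Submission
  imports Defs "HOL-Real_Asymp.Real_Asymp"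
begin

text \<open>
  The proof has a probabilistic half, in which the rate at which \<open>Z lam i k\<close> converges to the
  Poisson weight \<open>pois i lam\<close> for a uniformly random sequence is bounded, and a computability
  half, in which the deviations are made into a Martin-Loef test.

  Put \<open>h = b ^ (- k)\<close> and let \<open>z i m\<close> be the expected proportion of words of length \<open>k\<close>
  with exactly \<open>i\<close> occurrences among the first \<open>m\<close> positions. Admitting one more position changes the
  number of occurrences of a single word, namely of the block \<open>B\<close> that starts there
  (\<open>num_words_hit_Suc\<close>). Up to an event of probability \<open>O(k h)\<close>, the block \<open>B\<close> does not occur
  at the fewer than \<open>k\<close> positions before it whose blocks overlap it, and it is independent of the
  symbols that precede it, so it has had \<open>i\<close> occurrences with probability \<open>z i m + O(k h)\<close>
  (\<open>avg_recurrences\<close>). Therefore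
  \<open>z i (m + 1) = z i m + h (z (i - 1) m - z i m) + O(k h^2)\<close>. This is Euler's scheme with step \<open>h\<close> for
  the differential equations \<open>pois' i = pois (i - 1) - pois i\<close> of the Poisson process, and it
  does not amplify errors, so after \<open>lam / h\<close> steps the total error is \<open>O(k h)\<close>
  (\<open>avg_num_words_hit_near_pois\<close>).

  The random proportion is close to its mean. Changing one symbol of the sequence affects at most
  \<open>2 k\<close> words, so the Efron-Stein inequality (\<open>avg_variance_le\<close>) bounds the variance of the proportion by
  \<open>O(lam / h) (2 k h)^2\<close>, that is, by \<open>O(k^2 h)\<close> up to the \<open>k\<close> extra symbols of the last block.
  With Chebyshev's inequality, the probability of a deviation by a fixed amount decays exponentially in
  \<open>k\<close> up to a polynomial factor; it is in particular \<open>O(1 / k^2)\<close>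
  (\<open>measure_num_words_hit_far_from_pois\<close>).

  For fixed \<open>i\<close>, rational \<open>lam\<close> and a fixed rational tolerance, the deviation at
  length \<open>k\<close> is a decidable property of a prefix of the sequence. The effective Borel-Cantelli lemma
  (\<open>martin_loef_random_eventually_notin\<close>) shows that a random sequence has such deviations only for
  finitely many \<open>k\<close>. Real \<open>lam\<close> follow because \<open>Z\<close> and \<open>pois\<close> are Lipschitz in \<open>lam\<close>.
\<close>

section \<open>Recursive functions\<close>

text \<open>
  Closing \<^const>\<open>recursive\<close> under equality on lists of the right length lets the argument list
  be taken apart freely in the definition of a function. The rules below allow the arity \<open>n\<close> and
  the argument list \<open>xs\<close> to be arbitrary, and a bound variable is the head of a longer argument list.
\<close>

definition rec_fun :: "nat \<Rightarrow> (nat list \<Rightarrow> nat) \<Rightarrow> bool" where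
  "rec_fun n f \<longleftrightarrow> (\<exists>F. recursive n F \<and> (\<forall>xs. length xs = n \<longrightarrow> f xs = F xs))"

lemma rec_funI: "recursive n f \<Longrightarrow> rec_fun n f"
  unfolding rec_fun_def by blast

lemma rec_fun_cong:
  "rec_fun n f \<Longrightarrow> (\<And>xs. length xs = n \<Longrightarrow> g xs = f xs) \<Longrightarrow> rec_fun n g"
  unfolding rec_fun_def by auto

lemma rec_fun_nth: "i < n \<Longrightarrow> rec_fun n (\<lambda>xs. xs ! i)"
  by (rule rec_funI) (rule proj)

lemma rec_fun_comp:
  assumes f: "rec_fun (length gs) f" and gs: "\<forall>g\<in>set gs. rec_fun n g"
  shows "rec_fun n (\<lambda>xs. f (map (\<lambda>g. g xs) gs))"
proof -
  obtain F where F: "recursive (length gs) F" "\<And>xs. length xs = length gs \<Longrightarrow> f xs = F xs"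
    using f unfolding rec_fun_def by blast
  obtain G where G: "\<And>g. g \<in> set gs \<Longrightarrow> recursive n (G g)"
      "\<And>g xs. g \<in> set gs \<Longrightarrow> length xs = n \<Longrightarrow> g xs = G g xs"
    using gs unfolding rec_fun_def by metis
  have "recursive n (\<lambda>xs. F (map (\<lambda>g. g xs) (map G gs)))"
    by (rule comp) (use F(1) G(1) in auto)
  moreover have "f (map (\<lambda>g. g xs) gs) = F (map (\<lambda>g. g xs) (map G gs))" if "length xs = n" for xs
  proof -
    have eq: "map (\<lambda>g. g xs) gs = map (\<lambda>g. g xs) (map G gs)"
      using G(2) that by simp
    have "f (map (\<lambda>g. g xs) gs) = F (map (\<lambda>g. g xs) gs)"
      by (rule F(2)) simp
    then show ?thesis
      by (simp only: eq)
  qed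
  ultimately show ?thesis
    unfolding rec_fun_def by blast
qed

lemma rec_fun_comp1:
  assumes "rec_fun 1 (\<lambda>xs. f (xs ! 0))" "rec_fun n a"
  shows "rec_fun n (\<lambda>xs. f (a xs))"
  using rec_fun_comp[of "[a]" "\<lambda>xs. f (xs ! 0)" n] assms by simp

lemma rec_fun_comp2:
  assumes "rec_fun 2 (\<lambda>xs. f (xs ! 0) (xs ! 1))" "rec_fun n a" "rec_fun n b"
  shows "rec_fun n (\<lambda>xs. f (a xs) (b xs))"
  using rec_fun_comp[of "[a, b]" "\<lambda>xs. f (xs ! 0) (xs ! 1)" n] assms
  by (simp add: numeral_2_eq_2)

lemma rec_fun_comp3:
  assumes "rec_fun 3 (\<lambda>xs. f (xs ! 0) (xs ! 1) (xs ! 2))" "rec_fun n a" "rec_fun n b" "rec_fun n c"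
  shows "rec_fun n (\<lambda>xs. f (a xs) (b xs) (c xs))"
  using rec_fun_comp[of "[a, b, c]" "\<lambda>xs. f (xs ! 0) (xs ! 1) (xs ! 2)" n] assms
  by (simp add: numeral_2_eq_2 numeral_3_eq_3)

lemma rec_fun_Suc: "rec_fun n a \<Longrightarrow> rec_fun n (\<lambda>xs. Suc (a xs))"
  by (rule rec_fun_comp1[where f = Suc]) (rule rec_funI, rule succ)

lemma rec_fun_const: "rec_fun n (\<lambda>xs. c)"
  by (induction c) (simp_all add: rec_funI recursive.zero rec_fun_Suc)

lemma rec_fun_rec_nat_hd:
  assumes f: "rec_fun n f" and g: "rec_fun (n + 2) g"
  shows "rec_fun (Suc n) (\<lambda>xs. rec_nat (f (tl xs)) (\<lambda>j r. g (j # r # tl xs)) (hd xs))"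
proof -
  obtain F where F: "recursive n F" "\<And>xs. length xs = n \<Longrightarrow> f xs = F xs"
    using f unfolding rec_fun_def by blast
  obtain G where G: "recursive (n + 2) G" "\<And>xs. length xs = n + 2 \<Longrightarrow> g xs = G xs"
    using g unfolding rec_fun_def by blast
  have "rec_nat (f (tl xs)) (\<lambda>j r. g (j # r # tl xs)) m = rec_nat (F (tl xs)) (\<lambda>j r. G (j # r # tl xs)) m"
    if "length xs = Suc n" for xs m
    by (induction m) (use that F(2) G(2) in auto)
  then show ?thesis
    unfolding rec_fun_def using prim_rec[OF F(1) G(1)] by blast
qed

lemma rec_fun_rec_nat:
  assumes f: "rec_fun n f" and g: "rec_fun (n + 2) g" and b: "rec_fun n b"
  shows "rec_fun n (\<lambda>xs. rec_nat (f xs) (\<lambda>j r. g (j # r # xs)) (b xs))"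
proof -
  have "rec_fun n (\<lambda>xs. (\<lambda>ys. rec_nat (f (tl ys)) (\<lambda>j r. g (j # r # tl ys)) (hd ys))
      (map (\<lambda>g. g xs) (b # map (\<lambda>i xs. xs ! i) [0..<n])))"
    by (rule rec_fun_comp) (use rec_fun_rec_nat_hd[OF f g] b rec_fun_nth in auto)
  moreover have "map (\<lambda>g. g xs) (map (\<lambda>i xs. xs ! i) [0..<n]) = xs" if "length xs = n" for xs :: "nat list"
    using that by (auto intro: nth_equalityI)
  ultimately show ?thesis
    by (auto elim!: rec_fun_cong)
qed

lemma rec_fun_Least:
  assumes f: "rec_fun (Suc n) f" and ex: "\<And>xs. length xs = n \<Longrightarrow> \<exists>y. f (y # xs) = 0"
  shows "rec_fun n (\<lambda>xs. LEAST y. f (y # xs) = 0)"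
proof -
  obtain F where F: "recursive (Suc n) F" "\<And>xs. length xs = Suc n \<Longrightarrow> f xs = F xs"
    using f unfolding rec_fun_def by blast
  have "recursive n (\<lambda>xs. LEAST y. F (y # xs) = 0)"
    by (rule minimize[OF F(1)]) (use ex F(2) in fastforce)
  then show ?thesis
    unfolding rec_fun_def using F(2) by fastforce
qed

lemma rec_fun_add:
  assumes "rec_fun n a" "rec_fun n b"
  shows "rec_fun n (\<lambda>xs. a xs + b xs)"
proof -
  have "rec_fun n (\<lambda>xs. rec_nat (a xs) (\<lambda>j r. (\<lambda>ys. Suc (ys ! 1)) (j # r # xs)) (b xs))"
    by (intro rec_fun_rec_nat rec_fun_Suc rec_fun_nth assms) auto
  moreover have "rec_nat m (\<lambda>j r. Suc r) l = m + l" for m l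
    by (induction l) auto
  ultimately show ?thesis by simp
qed

lemma rec_fun_sum:
  assumes f: "rec_fun (Suc n) f" and b: "rec_fun n b"
  shows "rec_fun n (\<lambda>xs. \<Sum>j<b xs. f (j # xs))"
proof -
  let ?p = "map (\<lambda>i ys. ys ! Suc (Suc i)) [0..<n]"
  let ?g = "\<lambda>ys. ys ! 1 + f (map (\<lambda>g. g ys) ((\<lambda>ys. ys ! 0) # ?p))"
  have "rec_fun (n + 2) ?g"
    by (intro rec_fun_add rec_fun_comp rec_fun_nth) (use f rec_fun_nth in auto)
  then have "rec_fun n (\<lambda>xs. rec_nat 0 (\<lambda>j r. ?g (j # r # xs)) (b xs))"
    by (intro rec_fun_rec_nat rec_fun_const b)
  moreover have "(\<Sum>j<b xs. f (j # xs)) = rec_nat 0 (\<lambda>j r. ?g (j # r # xs)) (b xs)"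
    if "length xs = n" for xs
  proof -
    have p: "map (\<lambda>g. g (j # r # xs)) ?p = xs" for j r
      using that by (auto intro!: nth_equalityI)
    have "rec_nat 0 (\<lambda>j r. ?g (j # r # xs)) m = (\<Sum>j<m. f (j # xs))" for m
      by (induction m) (simp_all add: p del: map_map)
    then show ?thesis by simp
  qed
  ultimately show ?thesis
    by (rule rec_fun_cong)
qed

lemma rec_fun_mult:
  assumes "rec_fun n a" "rec_fun n b"
  shows "rec_fun n (\<lambda>xs. a xs * b xs)"
proof -
  have "rec_fun n (\<lambda>xs. \<Sum>j<b xs. a (map (\<lambda>g. g (j # xs)) (map (\<lambda>i ys. ys ! Suc i) [0..<n])))"
    using assms by (intro rec_fun_sum rec_fun_comp) (auto intro: rec_fun_nth)
  moreover have "map (\<lambda>g. g (j # xs)) (map (\<lambda>i ys. ys ! Suc i) [0..<n]) = xs"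
    if "length xs = n" for j and xs :: "nat list"
    using that by (auto intro: nth_equalityI)
  ultimately show ?thesis
    by (auto elim!: rec_fun_cong simp: mult.commute)
qed

lemma rec_fun_power:
  assumes "rec_fun n a"
  shows "rec_fun n (\<lambda>xs. c ^ a xs)"
proof -
  have "rec_fun n (\<lambda>xs. rec_nat 1 (\<lambda>j r. (\<lambda>ys. c * ys ! 1) (j # r # xs)) (a xs))"
    by (rule rec_fun_rec_nat[OF _ _ assms]; intro rec_fun_mult rec_fun_const rec_fun_nth) auto
  moreover have "rec_nat 1 (\<lambda>j r. c * r) l = c ^ l" for l
    by (induction l) auto
  ultimately show ?thesis by simp
qed

lemma rec_fun_diff:
  assumes "rec_fun n a" "rec_fun n b"
  shows "rec_fun n (\<lambda>xs. a xs - b xs)"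
proof -
  have "rec_fun 1 (\<lambda>xs. rec_nat 0 (\<lambda>j r. (\<lambda>ys. ys ! 0) (j # r # xs)) (xs ! 0))"
    by (rule rec_fun_rec_nat; intro rec_fun_const rec_fun_nth) auto
  moreover have "rec_nat 0 (\<lambda>j r. j) l = l - 1" for l :: nat
    by (cases l) auto
  ultimately have pred: "rec_fun 1 (\<lambda>xs. xs ! 0 - 1)"
    by simp
  have "rec_fun n (\<lambda>xs. rec_nat (a xs) (\<lambda>j r. (\<lambda>ys. ys ! 1 - 1) (j # r # xs)) (b xs))"
    by (rule rec_fun_rec_nat[OF assms(1) _ assms(2)], rule rec_fun_comp1[OF pred], rule rec_fun_nth) auto
  moreover have "rec_nat m (\<lambda>j r. r - 1) l = m - l" for m l :: nat
    by (induction l) auto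
  ultimately show ?thesis by simp
qed

abbreviation rec_pred :: "nat \<Rightarrow> (nat list \<Rightarrow> bool) \<Rightarrow> bool" where
  "rec_pred n P \<equiv> rec_fun n (\<lambda>xs. of_bool (P xs))"

lemma rec_pred_less:
  assumes "rec_fun n a" "rec_fun n b"
  shows "rec_pred n (\<lambda>xs. a xs < b xs)"
proof -
  have "rec_fun n (\<lambda>xs. 1 - (Suc (a xs) - b xs))"
    by (intro rec_fun_diff rec_fun_Suc rec_fun_const assms)
  then show ?thesis
    by (rule rec_fun_cong) auto
qed

lemma rec_pred_not: "rec_pred n P \<Longrightarrow> rec_pred n (\<lambda>xs. \<not> P xs)"
  unfolding of_bool_not_iff by (rule rec_fun_cong[OF rec_fun_diff[OF rec_fun_const[of n 1]]]) auto

lemma rec_pred_conj: "rec_pred n P \<Longrightarrow> rec_pred n Q \<Longrightarrow> rec_pred n (\<lambda>xs. P xs \<and> Q xs)"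
  unfolding of_bool_conj by (rule rec_fun_mult)

lemma rec_pred_disj: "rec_pred n P \<Longrightarrow> rec_pred n Q \<Longrightarrow> rec_pred n (\<lambda>xs. P xs \<or> Q xs)"
  using rec_pred_not[OF rec_pred_conj[OF rec_pred_not rec_pred_not]] by simp

lemma rec_pred_eq:
  assumes "rec_fun n a" "rec_fun n b"
  shows "rec_pred n (\<lambda>xs. a xs = b xs)"
proof -
  have "rec_pred n (\<lambda>xs. \<not> a xs < b xs \<and> \<not> b xs < a xs)"
    by (intro rec_pred_conj rec_pred_not rec_pred_less assms)
  then show ?thesis
    by (rule rec_fun_cong) (auto simp: not_less)
qed

lemma rec_fun_card:
  assumes P: "rec_pred (Suc n) P" and b: "rec_fun n b"
  shows "rec_fun n (\<lambda>xs. card {j. j < b xs \<and> P (j # xs)})"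
proof (rule rec_fun_cong[OF rec_fun_sum[OF P b]])
  fix xs
  have "(\<Sum>j<b xs. of_bool (P (j # xs)) :: nat) = card ({..<b xs} \<inter> {j. P (j # xs)})"
    by (simp add: sum_of_bool_eq)
  also have "{..<b xs} \<inter> {j. P (j # xs)} = {j. j < b xs \<and> P (j # xs)}"
    by auto
  finally show "card {j. j < b xs \<and> P (j # xs)} = (\<Sum>j<b xs. of_bool (P (j # xs)))"
    by simp
qed

lemma rec_pred_all:
  assumes P: "rec_pred (Suc n) P" and b: "rec_fun n b"
  shows "rec_pred n (\<lambda>xs. \<forall>j<b xs. P (j # xs))"
proof -
  have "rec_pred n (\<lambda>xs. card {j. j < b xs \<and> \<not> P (j # xs)} = 0)"
    by (intro rec_pred_eq rec_fun_card rec_pred_not rec_fun_const P b)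
  then show ?thesis
    by (rule rec_fun_cong) auto
qed

lemma rec_fun_If:
  assumes "rec_pred n P" "rec_fun n f" "rec_fun n g"
  shows "rec_fun n (\<lambda>xs. if P xs then f xs else g xs)"
proof -
  have "rec_fun n (\<lambda>xs. of_bool (P xs) * f xs + of_bool (\<not> P xs) * g xs)"
    by (intro rec_fun_add rec_fun_mult rec_pred_not assms)
  then show ?thesis
    by (rule rec_fun_cong) auto
qed

text \<open>
  The quotient \<open>l div m\<close> counts the \<open>j\<close> for which \<open>j + 1\<close> multiples of \<open>m\<close> fit into \<open>l\<close>.
\<close>

lemma rec_fun_div:
  assumes "rec_fun n a" "rec_fun n b"
  shows "rec_fun n (\<lambda>xs. a xs div b xs)"
proof -
  have "rec_fun 2 (\<lambda>xs. card {j. j < xs ! 0 \<and> (\<lambda>ys. 0 < ys ! 2 \<and> \<not> ys ! 1 < Suc (ys ! 0) * ys ! 2) (j # xs)})"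
    by (intro rec_fun_card rec_pred_conj rec_pred_not rec_pred_less rec_fun_mult rec_fun_Suc
        rec_fun_const rec_fun_nth) auto
  moreover have "card {j. j < l \<and> (0 < m \<and> \<not> l < Suc j * m)} = l div m" for l m :: nat
  proof (cases "m = 0")
    case False
    have "j < l \<and> (0 < m \<and> \<not> l < Suc j * m) \<longleftrightarrow> j < l div m" for j
    proof -
      have "Suc j \<le> l div m \<longleftrightarrow> Suc j * m \<le> l"
        using False by (simp add: less_eq_div_iff_mult_less_eq)
      moreover have "l div m \<le> l" by simp
      ultimately show ?thesis
        using False unfolding not_less Suc_le_eq by linarith
    qed
    then show ?thesis by simp
  qed simp
  ultimately have "rec_fun 2 (\<lambda>xs. xs ! 0 div xs ! 1)"
    by (elim rec_fun_cong) (simp add: numeral_2_eq_2)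
  then show ?thesis
    by (rule rec_fun_comp2) fact+
qed

lemma rec_fun_mod:
  assumes "rec_fun n a" "rec_fun n b"
  shows "rec_fun n (\<lambda>xs. a xs mod b xs)"
proof -
  have "rec_fun n (\<lambda>xs. a xs - a xs div b xs * b xs)"
    by (intro rec_fun_diff rec_fun_mult rec_fun_div assms)
  then show ?thesis
    by (simp add: minus_div_mult_eq_mod)
qed

lemma rec_fun_prod_encode:
  assumes "rec_fun n a" "rec_fun n b"
  shows "rec_fun n (\<lambda>xs. prod_encode (a xs, b xs))"
  unfolding prod_encode_def triangle_def split
  by (intro rec_fun_add rec_fun_div rec_fun_mult rec_fun_Suc rec_fun_const assms)

text \<open>
  The code of a list is built from its end, so the step that has already coded \<open>j\<close> entries
  prepends the entry with index \<open>l - (j + 1)\<close>.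
\<close>

lemma rec_fun_list_encode:
  assumes f: "rec_fun (Suc n) f" and l: "rec_fun n l"
  shows "rec_fun n (\<lambda>xs. list_encode (map (\<lambda>t. f (t # xs)) [0..<l xs]))"
proof -
  let ?p = "map (\<lambda>i ys. ys ! Suc (Suc i)) [0..<n]"
  let ?l = "\<lambda>ys. l (map (\<lambda>g. g ys) ?p) - Suc (ys ! 0)"
  let ?g = "\<lambda>ys. Suc (prod_encode (f (map (\<lambda>g. g ys) (?l # ?p)), ys ! 1))"
  have l': "rec_fun (n + 2) ?l"
    by (intro rec_fun_diff rec_fun_comp rec_fun_Suc rec_fun_nth) (use l rec_fun_nth in auto)
  have "rec_fun (n + 2) ?g"
    by (intro rec_fun_Suc rec_fun_prod_encode rec_fun_nth rec_fun_comp)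
      (use f l' rec_fun_nth in auto)
  then have "rec_fun n (\<lambda>xs. rec_nat 0 (\<lambda>j r. ?g (j # r # xs)) (l xs))"
    by (intro rec_fun_rec_nat rec_fun_const l)
  moreover have "list_encode (map (\<lambda>t. f (t # xs)) [0..<l xs]) =
      rec_nat 0 (\<lambda>j r. ?g (j # r # xs)) (l xs)" if "length xs = n" for xs
  proof -
    have p: "map (\<lambda>g. g (j # r # xs)) ?p = xs" for j r
      using that by (auto intro!: nth_equalityI)
    have "rec_nat 0 (\<lambda>j r. ?g (j # r # xs)) m =
        list_encode (map (\<lambda>t. f (t # xs)) [l xs - m..<l xs])" if "m \<le> l xs" for m
      using that
    proof (induction m)
      case (Suc m)
      then have "[l xs - Suc m..<l xs] = (l xs - Suc m) # [l xs - m..<l xs]"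
        by (subst upt_conv_Cons) (auto simp: Suc_diff_Suc)
      with Suc show ?case
        by (simp add: p del: map_map)
    qed simp
    from this[of "l xs"] show ?thesis by simp
  qed
  ultimately show ?thesis
    by (rule rec_fun_cong)
qed

section \<open>Averages over words\<close>

text \<open>
  The expectation of \<open>f\<close> over a uniformly random word of length \<open>n\<close>. The recursion conditions on the
  first letter, which is the form in which the variance bound and independence are used.
\<close>

primrec avg :: "nat \<Rightarrow> ('a::finite list \<Rightarrow> real) \<Rightarrow> real" where
  "avg 0 f = f []"
| "avg (Suc n) f = (\<Sum>a\<in>UNIV. avg n (\<lambda>w. f (a # w))) / real CARD('a)"

lemma avg_cong: "(\<And>w. length w = n \<Longrightarrow> f w = g w) \<Longrightarrow> avg n f = avg n g"
proof (induction n arbitrary: f g)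
  case (Suc n)
  have "avg n (\<lambda>w. f (a # w)) = avg n (\<lambda>w. g (a # w))" for a
    by (rule Suc.IH) (use Suc.prems in simp)
  then show ?case by simp
qed simp

lemma avg_const [simp]: "avg n (\<lambda>w. c) = c"
  by (induction n) auto

lemma avg_add: "avg n (\<lambda>w. f w + g w) = avg n f + avg n g"
  by (induction n arbitrary: f g) (simp_all add: sum.distrib add_divide_distrib)

lemma avg_cmult: "avg n (\<lambda>w. c * f w) = c * avg n f"
  by (induction n arbitrary: f) (simp_all add: sum_distrib_left)

lemma avg_diff: "avg n (\<lambda>w. f w - g w) = avg n f - avg n g"
  using avg_add[of n f "\<lambda>w. - 1 * g w"] by (simp only: avg_cmult) simp

lemma avg_sum: "avg n (\<lambda>w. \<Sum>j\<in>A. f j w) = (\<Sum>j\<in>A. avg n (f j))"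
proof (cases "finite A")
  case True
  then show ?thesis by (induction A rule: finite_induct) (simp_all add: avg_add)
qed simp

lemma avg_mono: "(\<And>w. length w = n \<Longrightarrow> f w \<le> g w) \<Longrightarrow> avg n f \<le> avg n g"
proof (induction n arbitrary: f g)
  case (Suc n)
  have "avg n (\<lambda>w. f (a # w)) \<le> avg n (\<lambda>w. g (a # w))" for a
    by (rule Suc.IH) (use Suc.prems in simp)
  then show ?case
    by (simp add: divide_right_mono sum_mono)
qed simp

lemma abs_avg_diff_le:
  assumes "\<And>w. length w = n \<Longrightarrow> \<bar>f w - g w\<bar> \<le> c w"
  shows "\<bar>avg n f - avg n g\<bar> \<le> avg n c"
proof -
  have "avg n (\<lambda>w. f w - g w) \<le> avg n c" "avg n (\<lambda>w. g w - f w) \<le> avg n c"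
    by (rule avg_mono, use assms in fastforce)+
  then show ?thesis by (simp add: avg_diff)
qed

text \<open>
  Independence of a prefix and the suffix that follows it.
\<close>

lemma avg_append: "avg (m + n) f = avg m (\<lambda>v. avg n (\<lambda>w. f (v @ w)))"
  by (induction m arbitrary: f) simp_all

lemma words_Suc: "{w. length w = Suc n \<and> P w} = (\<Union>a. (#) a ` {w. length w = n \<and> P (a # w)})"
  by (auto simp: length_Suc_conv)

lemma finite_words: "finite {w::'a::finite list. length w = n \<and> P w}"
proof (rule finite_subset)
  show "finite {w::'a list. set w \<subseteq> UNIV \<and> length w = n}"
    by (rule finite_lists_length_eq) simp
qed auto

lemma avg_of_bool:
  "avg n (\<lambda>w::'a::finite list. of_bool (P w)) = real (card {w. length w = n \<and> P w}) / real CARD('a) ^ n"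
proof (induction n arbitrary: P)
  case 0
  have "{w. length w = 0 \<and> P w} = (if P [] then {[]} else {})"
    by auto
  then show ?case by simp
next
  case (Suc n)
  have "card {w. length w = Suc n \<and> P w} = (\<Sum>a\<in>UNIV. card ((#) a ` {w. length w = n \<and> P (a # w)}))"
    unfolding words_Suc by (rule card_UN_disjoint) (auto intro: finite_words)
  also have "\<dots> = (\<Sum>a\<in>UNIV. card {w. length w = n \<and> P (a # w)})"
    by (intro sum.cong card_image) auto
  finally show ?case
    by (simp add: Suc sum_divide_distrib mult.commute)
qed

text \<open>
  A form of the Efron-Stein inequality. Conditioning on the first letter splits the variance into
  the average of the conditional variances, which is bounded by induction, and the variance of the
  conditional means. The latter is at most \<open>c ^ 2\<close> because any two conditional means differ by at
  most \<open>c\<close>.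
\<close>

lemma avg_variance_le:
  fixes f :: "'a::finite list \<Rightarrow> real"
  assumes "\<And>v a a' w. Suc (length v + length w) = n \<Longrightarrow> \<bar>f (v @ a # w) - f (v @ a' # w)\<bar> \<le> c"
  shows "avg n (\<lambda>w. (f w - avg n f)\<^sup>2) \<le> real n * c\<^sup>2"
  using assms
proof (induction n arbitrary: f)
  case (Suc n)
  define g where "g = (\<lambda>a w. f (a # w))"
  let ?b = "real CARD('a)"
  define \<mu> where "\<mu> = avg (Suc n) f"
  have avgf: "\<mu> = (\<Sum>a\<in>UNIV. avg n (g a)) / ?b"
    by (simp add: g_def \<mu>_def)
  have IH: "avg n (\<lambda>w. (g a w - avg n (g a))\<^sup>2) \<le> real n * c\<^sup>2" for a
  proof (rule Suc.IH)
    fix v w :: "'a list" and a' a''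
    assume "Suc (length v + length w) = n"
    then show "\<bar>g a (v @ a' # w) - g a (v @ a'' # w)\<bar> \<le> c"
      using Suc.prems[of "a # v" w a' a''] by (simp add: g_def)
  qed
  have "\<bar>avg n (g a) - avg n (g a')\<bar> \<le> c" for a a'
    using abs_avg_diff_le[of n "g a" "g a'" "\<lambda>_. c"] Suc.prems[of "[]" _ a a'] by (simp add: g_def)
  then have "\<bar>\<Sum>a'\<in>UNIV. avg n (g a) - avg n (g a')\<bar> \<le> (\<Sum>a'\<in>(UNIV::'a set). c)" for a
    by (intro order_trans[OF sum_abs] sum_mono)
  moreover have "avg n (g a) - \<mu> = (\<Sum>a'\<in>UNIV. avg n (g a) - avg n (g a')) / ?b" for a
    by (simp add: avgf sum_subtractf field_simps)
  ultimately have dev: "\<bar>avg n (g a) - \<mu>\<bar> \<le> c" for a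
    by (simp add: abs_divide divide_le_eq mult.commute)
  have "avg n (\<lambda>w. (g a w - \<mu>)\<^sup>2) \<le> real (Suc n) * c\<^sup>2" for a
  proof -
    \<comment> \<open>The cross term has mean zero.\<close>
    have "(g a w - \<mu>)\<^sup>2 = ((g a w - avg n (g a))\<^sup>2 + (2 * (avg n (g a) - \<mu>)) * (g a w - avg n (g a)))
        + (avg n (g a) - \<mu>)\<^sup>2" for w
      by (simp add: power2_eq_square algebra_simps)
    then have "avg n (\<lambda>w. (g a w - \<mu>)\<^sup>2) =
        avg n (\<lambda>w. (g a w - avg n (g a))\<^sup>2) + (avg n (g a) - \<mu>)\<^sup>2"
      by (simp only: avg_add avg_cmult avg_diff avg_const) simp
    moreover have "(avg n (g a) - \<mu>)\<^sup>2 \<le> c\<^sup>2"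
      using power_mono[OF dev, of a 2] by simp
    ultimately show ?thesis
      using IH[of a] by (simp add: algebra_simps)
  qed
  then have "(\<Sum>a\<in>UNIV. avg n (\<lambda>w. (g a w - \<mu>)\<^sup>2)) \<le> (\<Sum>a\<in>(UNIV::'a set). real (Suc n) * c\<^sup>2)"
    by (rule sum_mono)
  then have "(\<Sum>a\<in>UNIV. avg n (\<lambda>w. (g a w - \<mu>)\<^sup>2)) / ?b \<le> real (Suc n) * c\<^sup>2"
    by (simp add: divide_le_eq mult.commute)
  then show ?case
    unfolding \<mu>_def[symmetric] by (simp add: g_def del: of_nat_Suc)
qed simp

text \<open>
  Chebyshev's inequality for the variance bound above.
\<close>

lemma avg_deviation_le:
  fixes f :: "'a::finite list \<Rightarrow> real"
  assumes "\<And>v a a' w. Suc (length v + length w) = n \<Longrightarrow> \<bar>f (v @ a # w) - f (v @ a' # w)\<bar> \<le> c"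
    and "\<epsilon> > 0"
  shows "avg n (\<lambda>w. of_bool (\<epsilon> \<le> \<bar>f w - avg n f\<bar>)) \<le> real n * c\<^sup>2 / \<epsilon>\<^sup>2"
proof -
  have "of_bool (\<epsilon> \<le> \<bar>f w - avg n f\<bar>) \<le> 1 / \<epsilon>\<^sup>2 * (f w - avg n f)\<^sup>2" for w
    using power_mono[of \<epsilon> "\<bar>f w - avg n f\<bar>" 2] assms(2) by (auto simp: field_simps)
  then have "avg n (\<lambda>w. of_bool (\<epsilon> \<le> \<bar>f w - avg n f\<bar>)) \<le> 1 / \<epsilon>\<^sup>2 * avg n (\<lambda>w. (f w - avg n f)\<^sup>2)"
    unfolding avg_cmult[symmetric] by (rule avg_mono)
  also have "\<dots> \<le> 1 / \<epsilon>\<^sup>2 * (real n * c\<^sup>2)"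
    by (intro mult_left_mono avg_variance_le assms(1)) auto
  finally show ?thesis by simp
qed

lemma prob_space_uniform_seq: "prob_space (uniform_seq_measure :: (nat \<Rightarrow> 'a::finite) measure)"
  unfolding uniform_seq_measure_def
  by (intro prob_space_PiM prob_space_uniform_count_measure) auto

lemma sets_cylinder: "cylinder w \<in> sets (uniform_seq_measure :: (nat \<Rightarrow> 'a::finite) measure)"
proof -
  let ?M = "uniform_count_measure (UNIV :: 'a set)"
  have "prod_emb UNIV (\<lambda>_. ?M) {..<length w} (\<Pi>\<^sub>E i\<in>{..<length w}. {w ! i}) \<in> sets (\<Pi>\<^sub>M i\<in>UNIV. ?M)"
    by (rule sets_PiM_I) (auto simp: sets_uniform_count_measure)
  also have "prod_emb UNIV (\<lambda>_. ?M) {..<length w} (\<Pi>\<^sub>E i\<in>{..<length w}. {w ! i}) = cylinder w"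
  proof (rule set_eqI)
    fix x :: "nat \<Rightarrow> 'a"
    show "x \<in> prod_emb UNIV (\<lambda>_. ?M) {..<length w} (\<Pi>\<^sub>E i\<in>{..<length w}. {w ! i}) \<longleftrightarrow> x \<in> cylinder w"
      unfolding prod_emb_iff cylinder_altdef restrict_PiE_iff space_uniform_count_measure
        mem_Collect_eq extensional_UNIV by blast
  qed
  finally show ?thesis
    by (simp add: uniform_seq_measure_def)
qed

text \<open>
  Events that depend on a prefix are finite unions of cylinders; this reduces all measures to
  counting words.
\<close>

lemma measure_prefix:
  fixes P :: "'a::finite list \<Rightarrow> bool" and n :: nat
  defines "E \<equiv> {x. P (map x [0..<n])}"
  shows "E \<in> sets uniform_seq_measure" "measure uniform_seq_measure E = avg n (\<lambda>w. of_bool (P w))"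
proof -
  interpret prob_space "uniform_seq_measure :: (nat \<Rightarrow> 'a) measure"
    by (rule prob_space_uniform_seq)
  let ?W = "{w. length w = n \<and> P w}"
  have mem: "x \<in> cylinder w \<longleftrightarrow> w = map x [0..<n]" if "length w = n" for x and w :: "'a list"
    using that by (auto simp: cylinder_altdef list_eq_iff_nth_eq)
  have E: "E = (\<Union>w\<in>?W. cylinder w)"
    using mem by (auto simp: E_def)
  show "E \<in> sets uniform_seq_measure"
    unfolding E by (intro sets.finite_UN finite_words sets_cylinder)
  have "measure uniform_seq_measure E = (\<Sum>w\<in>?W. measure uniform_seq_measure (cylinder w))"
    unfolding E
  proof (rule finite_measure_finite_Union)
    show "disjoint_family_on cylinder ?W"
      using mem by (auto simp: disjoint_family_on_def)
  qed (auto intro: finite_words sets_cylinder)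
  then show "measure uniform_seq_measure E = avg n (\<lambda>w. of_bool (P w))"
    by (simp add: measure_cylinder avg_of_bool)
qed

section \<open>Occurrences of words\<close>

text \<open>
  Positions start from \<open>0\<close> here. The pattern \<open>y\<close> is a function, of which only the first \<open>k\<close> values
  matter, so that it can be a word or a block of \<open>x\<close> itself.
\<close>

definition occurrences :: "nat \<Rightarrow> nat \<Rightarrow> (nat \<Rightarrow> 'a) \<Rightarrow> (nat \<Rightarrow> 'a) \<Rightarrow> nat" where
  "occurrences k m x y = card {j. j < m \<and> (\<forall>t<k. x (j + t) = y t)}"

text \<open>
  When position \<open>m\<close> is added, only the block that starts there gains an occurrence; this is the
  number of occurrences that it had before.
\<close>

definition recurrences :: "nat \<Rightarrow> nat \<Rightarrow> (nat \<Rightarrow> 'a) \<Rightarrow> nat" where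
  "recurrences k m x = occurrences k m x (\<lambda>t. x (m + t))"

definition num_words_hit :: "nat \<Rightarrow> nat \<Rightarrow> nat \<Rightarrow> (nat \<Rightarrow> 'a::finite) \<Rightarrow> nat" where
  "num_words_hit k m i x = card {w :: 'a list. length w = k \<and> occurrences k m x ((!) w) = i}"

lemma occurrences_0 [simp]: "occurrences k 0 x y = 0"
  by (simp add: occurrences_def)

lemma occurrences_Suc:
  "occurrences k (Suc m) x y = occurrences k m x y + of_bool (\<forall>t<k. x (m + t) = y t)"
proof -
  have "{j. j < Suc m \<and> (\<forall>t<k. x (j + t) = y t)} =
      {j. j < m \<and> (\<forall>t<k. x (j + t) = y t)} \<union> (if \<forall>t<k. x (m + t) = y t then {m} else {})"
    by (auto simp: less_Suc_eq)
  then show ?thesis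
    unfolding occurrences_def by simp
qed

lemma occurrences_cong:
  assumes "\<And>s. 0 < m \<Longrightarrow> Suc s < m + k \<Longrightarrow> x s = x' s" "\<And>t. t < k \<Longrightarrow> y t = y' t"
  shows "occurrences k m x y = occurrences k m x' y'"
proof -
  have "j < m \<and> (\<forall>t<k. x (j + t) = y t) \<longleftrightarrow> j < m \<and> (\<forall>t<k. x' (j + t) = y' t)" for j
    using assms by auto
  then show ?thesis
    unfolding occurrences_def by simp
qed

lemma occurrences_extend:
  assumes "m' \<le> m" "\<And>j. m' \<le> j \<Longrightarrow> j < m \<Longrightarrow> \<not> (\<forall>t<k. x (j + t) = y t)"
  shows "occurrences k m x y = occurrences k m' x y"
proof -
  have "{j. j < m \<and> (\<forall>t<k. x (j + t) = y t)} = {j. j < m' \<and> (\<forall>t<k. x (j + t) = y t)}"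
  proof (rule Collect_cong)
    fix j
    show "j < m \<and> (\<forall>t<k. x (j + t) = y t) \<longleftrightarrow> j < m' \<and> (\<forall>t<k. x (j + t) = y t)"
      using assms(1) assms(2)[of j] by (cases "j < m'") auto
  qed
  then show ?thesis
    unfolding occurrences_def by simp
qed

lemma num_words_hit_cong:
  assumes "\<And>s. 0 < m \<Longrightarrow> Suc s < m + k \<Longrightarrow> x s = x' s"
  shows "num_words_hit k m i x = num_words_hit k m i x'"
proof -
  have "occurrences k m x y = occurrences k m x' y" for y
    by (rule occurrences_cong) (use assms in auto)
  then show ?thesis
    unfolding num_words_hit_def by simp
qed

lemma num_words_hit_0: "num_words_hit k 0 i (x :: nat \<Rightarrow> 'a::finite) = (if i = 0 then CARD('a) ^ k else 0)"
  using card_lists_length_eq[of "UNIV :: 'a set" k] by (simp add: num_words_hit_def)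

lemma sum_words_of_bool:
  "(\<Sum>w::'a::finite list | length w = k. of_bool (P w)) = (of_nat (card {w. length w = k \<and> P w}) :: 'b::semiring_1)"
proof -
  have "{w::'a list. length w = k} \<inter> {w. P w} = {w. length w = k \<and> P w}"
    by blast
  moreover have "finite {w::'a list. length w = k}"
    using finite_words[of k "\<lambda>_. True"] by simp
  ultimately show ?thesis
    by (metis sum_of_bool_eq)
qed

lemma num_words_hit_eq_sum:
  "num_words_hit k m i (x :: nat \<Rightarrow> 'a::finite) =
    (\<Sum>w | length w = k. of_bool (occurrences k m x ((!) w) = i))"
  unfolding num_words_hit_def sum_words_of_bool by simp

text \<open>
  Position \<open>m\<close> contributes an occurrence of the block \<open>w0\<close> that starts there and of no other word.
  So only \<open>w0\<close> moves, from the words with \<open>recurrences k m x\<close> occurrences to those with one more.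
\<close>

lemma num_words_hit_Suc:
  "real (num_words_hit k (Suc m) i x) =
    real (num_words_hit k m i x) + of_bool (Suc (recurrences k m x) = i) - of_bool (recurrences k m x = i)"
proof -
  let ?W = "{w :: 'a list. length w = k}"
  define w0 where "w0 = map (\<lambda>t. x (m + t)) [0..<k]"
  have fin: "finite ?W"
    using finite_words[where P = "\<lambda>_. True"] by simp
  have w0: "w0 \<in> ?W"
    by (simp add: w0_def)
  have other: "occurrences k (Suc m) x ((!) w) = occurrences k m x ((!) w)" if "w \<in> ?W - {w0}" for w
  proof -
    have "w = w0" if "\<forall>t<k. x (m + t) = w ! t"
      using that \<open>w \<in> ?W - {w0}\<close> by (intro nth_equalityI) (auto simp: w0_def)
    then show ?thesis
      using that unfolding occurrences_Suc by auto
  qed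
  have r: "occurrences k m x ((!) w0) = recurrences k m x"
    unfolding recurrences_def by (rule occurrences_cong) (auto simp: w0_def)
  then have r': "occurrences k (Suc m) x ((!) w0) = Suc (recurrences k m x)"
    unfolding occurrences_Suc by (auto simp: w0_def)
  have "(\<Sum>w\<in>?W - {w0}. of_bool (occurrences k (Suc m) x ((!) w) = i) :: nat) =
      (\<Sum>w\<in>?W - {w0}. of_bool (occurrences k m x ((!) w) = i))"
    by (rule sum.cong) (use other in auto)
  then have "num_words_hit k (Suc m) i x + of_bool (recurrences k m x = i) =
      num_words_hit k m i x + of_bool (Suc (recurrences k m x) = i)"
    unfolding num_words_hit_eq_sum sum.remove[OF fin w0] r r' by linarith
  then show ?thesis
    by (metis (no_types, lifting) add_diff_cancel_right' of_nat_add of_nat_of_bool)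
qed

lemma abs_num_words_hit_diff_le:
  "m \<le> m' \<Longrightarrow> \<bar>real (num_words_hit k m' i x) - real (num_words_hit k m i x)\<bar> \<le> real (m' - m)"
proof (induction m' rule: dec_induct)
  case (step m')
  have "\<bar>real (num_words_hit k (Suc m') i x) - real (num_words_hit k m' i x)\<bar> \<le> 1"
    unfolding num_words_hit_Suc by (simp add: of_bool_def)
  moreover have "real (Suc m' - m) = real (m' - m) + 1"
    using step.hyps by simp
  ultimately show ?case
    using step.IH by linarith
qed simp

text \<open>
  Only the at most \<open>k\<close> blocks through position \<open>p\<close> change, and only the words that equal one of these
  blocks, before or after the change, can have a different number of occurrences.
\<close>

lemma abs_num_words_hit_update_le:
  fixes x x' :: "nat \<Rightarrow> 'a::finite"
  assumes "\<And>s. s \<noteq> p \<Longrightarrow> x s = x' s"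
  shows "\<bar>real (num_words_hit k m i x) - real (num_words_hit k m i x')\<bar> \<le> 2 * real k"
proof -
  let ?W = "{w :: 'a list. length w = k}"
  let ?S = "{w \<in> ?W. occurrences k m x ((!) w) \<noteq> occurrences k m x' ((!) w)}"
  let ?J = "{p + 1 - k..p}"
  let ?blk = "\<lambda>x j. map (\<lambda>t. x (j + t)) [0..<k] :: 'a list"
  \<comment> \<open>The positions in \<open>?J\<close> are those whose blocks contain position \<open>p\<close>.\<close>
  have sub: "?S \<subseteq> ?blk x ` ?J \<union> ?blk x' ` ?J"
  proof (rule subsetI, rule ccontr)
    fix w assume w: "w \<in> ?S" and nin: "w \<notin> ?blk x ` ?J \<union> ?blk x' ` ?J"
    have blk: "w = ?blk y j" if "\<forall>t<k. y (j + t) = w ! t" for y j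
      using that w by (intro nth_equalityI) auto
    have no: "\<not> (\<forall>t<k. x (j + t) = w ! t) \<and> \<not> (\<forall>t<k. x' (j + t) = w ! t)" if "j \<in> ?J" for j
      using that blk[of x j] blk[of x' j] nin by blast
    have "(\<forall>t<k. x (j + t) = w ! t) \<longleftrightarrow> (\<forall>t<k. x' (j + t) = w ! t)" for j
    proof (cases "j \<in> ?J")
      case False
      then have "j + t \<noteq> p" if "t < k" for t
        using that by auto
      then show ?thesis
        using assms by metis
    qed (use no in blast)
    then show False
      using w unfolding occurrences_def by simp
  qed
  have "card ?S \<le> card (?blk x ` ?J) + card (?blk x' ` ?J)"
    by (rule order_trans[OF card_mono[OF _ sub] card_Un_le]) simp
  also have "\<dots> \<le> card ?J + card ?J"
    by (intro add_mono card_image_le) auto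
  also have "\<dots> \<le> 2 * k" by simp
  finally have S: "card ?S \<le> 2 * k" .
  have "\<bar>real (num_words_hit k m i x) - real (num_words_hit k m i x')\<bar> =
      \<bar>\<Sum>w\<in>?W. of_bool (occurrences k m x ((!) w) = i) - of_bool (occurrences k m x' ((!) w) = i)\<bar>"
    by (simp add: num_words_hit_eq_sum sum_subtractf)
  also have "\<dots> \<le> (\<Sum>w\<in>?W. of_bool (occurrences k m x ((!) w) \<noteq> occurrences k m x' ((!) w)))"
    by (intro order_trans[OF sum_abs] sum_mono) auto
  also have "\<dots> = real (card ?S)"
    by (simp add: sum_words_of_bool)
  finally show ?thesis
    using S by simp
qed

lemma avg_block:
  assumes "m + k \<le> n"
  shows "avg n f = avg m (\<lambda>v. avg k (\<lambda>w. avg (n - (m + k)) (\<lambda>r. f (v @ w @ r))))"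
proof -
  have "avg n f = avg (m + (k + (n - (m + k)))) f"
    using assms by simp
  then show ?thesis
    by (simp only: avg_append)
qed

text \<open>
  Given the first \<open>m\<close> letters, the equality of the blocks at \<open>j\<close> and \<open>m\<close> determines the letters of
  the second block one after the other, even when the two blocks overlap. So at most one of the
  \<open>b ^ k\<close> continuations by a block is possible.
\<close>

lemma avg_repeat_le:
  assumes "j < m" "m + k \<le> n"
  shows "avg n (\<lambda>u::'a::finite list. of_bool (\<forall>t<k. u ! (j + t) = u ! (m + t))) \<le> 1 / real CARD('a) ^ k"
proof -
  have "avg k (\<lambda>w. avg (n - (m + k)) (\<lambda>r. of_bool (\<forall>t<k. (v @ w @ r) ! (j + t) = (v @ w @ r) ! (m + t))))
      \<le> 1 / real CARD('a) ^ k" if v: "length v = m" for v :: "'a list"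
  proof -
    let ?P = "\<lambda>w. \<forall>t<k. (v @ w) ! (j + t) = w ! t"
    have eq: "w = w'" if "length w = k" "?P w" "length w' = k" "?P w'" for w w'
    proof -
      have "t < k \<longrightarrow> w ! t = w' ! t" for t
      proof (induction t rule: less_induct)
        case (less t)
        show ?case
        proof
          assume t: "t < k"
          then have "w ! t = (v @ w) ! (j + t)" "w' ! t = (v @ w') ! (j + t)"
            using that by auto
          moreover have "j + t - m < t" if "m \<le> j + t"
            using that assms(1) by linarith
          ultimately show "w ! t = w' ! t"
            using less t v by (auto simp: nth_append)
        qed
      qed
      then show ?thesis
        using that by (auto intro: nth_equalityI)
    qed
    have "card {w. length w = k \<and> ?P w} \<le> 1"
      using eq by (simp add: card_le_Suc0_iff_eq finite_words)
    then have "avg k (\<lambda>w. of_bool (?P w)) \<le> 1 / real CARD('a) ^ k"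
      unfolding avg_of_bool by (simp add: divide_right_mono)
    also have "avg k (\<lambda>w. of_bool (?P w)) = avg k (\<lambda>w. avg (n - (m + k))
        (\<lambda>r. of_bool (\<forall>t<k. (v @ w @ r) ! (j + t) = (v @ w @ r) ! (m + t))))"
    proof (rule avg_cong)
      fix w :: "'a list" assume w: "length w = k"
      have "(v @ w @ r) ! (j + t) = (v @ w) ! (j + t)" "(v @ w @ r) ! (m + t) = w ! t" if "t < k" for t r
        using that v w assms(1) by (auto simp: nth_append)
      then show "of_bool (?P w) = avg (n - (m + k))
          (\<lambda>r. of_bool (\<forall>t<k. (v @ w @ r) ! (j + t) = (v @ w @ r) ! (m + t)))"
        by simp
    qed
    finally show ?thesis .
  qed
  then show ?thesis
    unfolding avg_block[OF assms(2)] by (rule order_trans[OF avg_mono]) auto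
qed

text \<open>
  If the first \<open>m'\<close> blocks end before position \<open>m\<close>, then the block at \<open>m\<close> is a uniformly
  random word that is independent of them.
\<close>

lemma avg_next_block:
  assumes "m + k \<le> n" "m' = 0 \<or> m' + k \<le> Suc m"
  shows "avg n (\<lambda>u::'a::finite list. of_bool (occurrences k m' ((!) u) (\<lambda>t. u ! (m + t)) = i)) =
    avg n (\<lambda>u::'a list. real (num_words_hit k m' i ((!) u))) / real CARD('a) ^ k"
proof -
  have "avg n (\<lambda>u::'a list. of_bool (occurrences k m' ((!) u) (\<lambda>t. u ! (m + t)) = i)) =
      avg m (\<lambda>v::'a list. avg k (\<lambda>w. avg (n - (m + k)) (\<lambda>r::'a list. of_bool (occurrences k m' ((!) v) ((!) w) = i))))"
    unfolding avg_block[OF assms(1)]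
  proof (intro avg_cong)
    fix v w r :: "'a list"
    assume len: "length v = m" "length w = k"
    have "occurrences k m' ((!) (v @ w @ r)) (\<lambda>t. (v @ w @ r) ! (m + t)) = occurrences k m' ((!) v) ((!) w)"
      by (rule occurrences_cong) (use len assms(2) in \<open>auto simp: nth_append\<close>)
    then show "of_bool (occurrences k m' ((!) (v @ w @ r)) (\<lambda>t. (v @ w @ r) ! (m + t)) = i) =
        (of_bool (occurrences k m' ((!) v) ((!) w) = i) :: real)"
      by simp
  qed
  also have "\<dots> = avg m (\<lambda>v::'a list. 1 / real CARD('a) ^ k * real (num_words_hit k m' i ((!) v)))"
    by (simp add: avg_of_bool num_words_hit_def)
  also have "\<dots> = 1 / real CARD('a) ^ k * avg m (\<lambda>v::'a list. real (num_words_hit k m' i ((!) v)))"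
    by (rule avg_cmult)
  also have "avg m (\<lambda>v::'a list. real (num_words_hit k m' i ((!) v))) =
      avg n (\<lambda>u::'a list. real (num_words_hit k m' i ((!) u)))"
    unfolding avg_block[OF assms(1)]
  proof -
    have eq: "real (num_words_hit k m' i ((!) v)) =
        avg k (\<lambda>w. avg (n - (m + k)) (\<lambda>r. real (num_words_hit k m' i ((!) (v @ w @ r)))))"
      if "length v = m" for v :: "'a list"
    proof -
      have "num_words_hit k m' i ((!) (v @ w @ r)) = num_words_hit k m' i ((!) v)" for w r
        by (rule num_words_hit_cong) (use that assms(2) in \<open>auto simp: nth_append\<close>)
      then show ?thesis by simp
    qed
    show "avg m (\<lambda>v::'a list. real (num_words_hit k m' i ((!) v))) = avg m (\<lambda>v::'a list. avg k
        (\<lambda>w. avg (n - (m + k)) (\<lambda>r. real (num_words_hit k m' i ((!) (v @ w @ r))))))"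
      by (rule avg_cong) (rule eq)
  qed
  finally show ?thesis by simp
qed

text \<open>
  The block at \<open>m\<close> is compared with an independent uniformly random word. To this end the occurrences
  that may overlap it, of which there are fewer than \<open>k\<close>, are dropped: each is present with probability
  at most \<open>b ^ (- k)\<close>. Removing the same positions from \<open>num_words_hit\<close> costs as much again.
\<close>

lemma avg_recurrences:
  assumes "m + k \<le> n" "1 \<le> k"
  shows "\<bar>avg n (\<lambda>u::'a::finite list. of_bool (recurrences k m ((!) u) = i)) -
      avg n (\<lambda>u::'a list. real (num_words_hit k m i ((!) u))) / real CARD('a) ^ k\<bar> \<le> 2 * real k / real CARD('a) ^ k"
proof -
  let ?h = "1 / real CARD('a) ^ k"
  define m' where "m' = m + 1 - k"
  have m': "m' \<le> m" "m - m' \<le> k"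
    using assms(2) by (auto simp: m'_def)
  \<comment> \<open>The blocks that start before \<open>m'\<close> end before \<open>m\<close>; those that start from \<open>m'\<close> on overlap
    the block at \<open>m\<close>.\<close>
  let ?far = "\<lambda>u::'a list. of_bool (occurrences k m' ((!) u) (\<lambda>t. u ! (m + t)) = i) :: real"
  let ?near = "\<lambda>u::'a list. \<Sum>j=m'..<m. of_bool (\<forall>t<k. u ! (j + t) = u ! (m + t)) :: real"
  have "\<bar>of_bool (recurrences k m ((!) u) = i) - ?far u\<bar> \<le> ?near u" for u
  proof (cases "\<exists>j\<in>{m'..<m}. \<forall>t<k. u ! (j + t) = u ! (m + t)")
    case True
    then obtain j where j: "j \<in> {m'..<m}" "\<forall>t<k. u ! (j + t) = u ! (m + t)" by blast
    have "1 \<le> ?near u"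
      using member_le_sum[of j "{m'..<m}" "\<lambda>j. of_bool (\<forall>t<k. u ! (j + t) = u ! (m + t)) :: real"] j
      by simp
    then show ?thesis by auto
  next
    case False
    then have "recurrences k m ((!) u) = occurrences k m' ((!) u) (\<lambda>t. u ! (m + t))"
      unfolding recurrences_def using m'(1) by (intro occurrences_extend) auto
    then show ?thesis
      by (simp add: sum_nonneg)
  qed
  then have "\<bar>avg n (\<lambda>u::'a list. of_bool (recurrences k m ((!) u) = i)) - avg n ?far\<bar> \<le> avg n ?near"
    by (rule abs_avg_diff_le)
  also have "avg n ?near \<le> (\<Sum>j=m'..<m. ?h)"
    unfolding avg_sum by (intro sum_mono avg_repeat_le assms(1)) auto
  also have "\<dots> \<le> real k * ?h"
    using m'(2) by (simp add: divide_right_mono)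
  finally have near: "\<bar>avg n (\<lambda>u::'a list. of_bool (recurrences k m ((!) u) = i)) - avg n ?far\<bar> \<le> real k * ?h" .
  have far: "avg n ?far = avg n (\<lambda>u::'a list. real (num_words_hit k m' i ((!) u))) / real CARD('a) ^ k"
    by (rule avg_next_block) (use assms in \<open>auto simp: m'_def\<close>)
  have "\<bar>avg n (\<lambda>u::'a list. real (num_words_hit k m i ((!) u))) - avg n (\<lambda>u::'a list. real (num_words_hit k m' i ((!) u)))\<bar>
      \<le> avg n (\<lambda>u::'a list. real (m - m'))"
    by (intro abs_avg_diff_le abs_num_words_hit_diff_le m')
  also have "\<dots> \<le> real k"
    using m'(2) by simp
  finally have "\<bar>avg n (\<lambda>u::'a list. real (num_words_hit k m i ((!) u))) / real CARD('a) ^ k - avg n ?far\<bar> \<le> real k * ?h"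
    unfolding far by (simp add: divide_right_mono flip: diff_divide_distrib)
  then show ?thesis
    using near by (simp add: add_divide_distrib)
qed

section \<open>The Poisson limit and its rate\<close>

definition pois :: "nat \<Rightarrow> real \<Rightarrow> real" where
  "pois i t = exp (- t) * t ^ i / fact i"

text \<open>
  The right-hand side of the differential equations of the Poisson process with rate \<open>1\<close>.
\<close>

definition pois_deriv :: "nat \<Rightarrow> real \<Rightarrow> real" where
  "pois_deriv i t = (case i of 0 \<Rightarrow> 0 | Suc l \<Rightarrow> pois l t) - pois i t"

lemma pois_nonneg: "0 \<le> t \<Longrightarrow> 0 \<le> pois i t"
  by (simp add: pois_def)

lemma pois_le_1:
  assumes "0 \<le> t"
  shows "pois i t \<le> 1"
proof -
  have "t ^ i / fact i \<le> (\<Sum>l\<in>{i}. t ^ l /\<^sub>R fact l)"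
    by (simp add: divide_inverse mult.commute)
  also have "\<dots> \<le> exp t"
    unfolding exp_def by (rule sum_le_suminf) (use assms in \<open>auto simp: summable_exp\<close>)
  finally show ?thesis
    by (simp add: pois_def exp_minus field_simps)
qed

lemma abs_pois_deriv_le: "0 \<le> t \<Longrightarrow> \<bar>pois_deriv i t\<bar> \<le> 1"
  using pois_nonneg[of t i] pois_le_1[of t i] pois_nonneg[of t "i - 1"] pois_le_1[of t "i - 1"]
  by (cases i) (auto simp: pois_deriv_def)

lemma DERIV_pois: "(pois i has_real_derivative pois_deriv i t) (at t)"
proof (cases i)
  case 0
  then show ?thesis
    unfolding pois_def[abs_def] pois_deriv_def by (auto intro!: derivative_eq_intros)
next
  case (Suc l)
  then show ?thesis
    unfolding pois_def[abs_def] pois_deriv_def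
    by (auto intro!: derivative_eq_intros simp: field_simps simp del: power_Suc fact_Suc)
      (simp add: field_simps)
qed

lemma DERIV_pois_deriv:
  "(pois_deriv i has_real_derivative (case i of 0 \<Rightarrow> 0 | Suc l \<Rightarrow> pois_deriv l t) - pois_deriv i t) (at t)"
  unfolding pois_deriv_def[of i, abs_def]
  by (cases i) (auto intro!: derivative_eq_intros DERIV_pois, simp_all add: pois_deriv_def)

text \<open>
  The local error of Euler's scheme; the factor \<open>2\<close> bounds the second derivative of \<open>pois i\<close>.
\<close>

lemma pois_euler_step:
  assumes "0 \<le> t" "0 < h"
  shows "\<bar>pois i (t + h) - pois i t - h * pois_deriv i t\<bar> \<le> 2 * h\<^sup>2"
proof -
  have "\<exists>s>t. s < t + h \<and> pois i (t + h) - pois i t = (t + h - t) * pois_deriv i s"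
    by (rule MVT2) (use assms(2) in \<open>simp_all add: DERIV_pois\<close>)
  then obtain s where s: "t < s" "s < t + h" "pois i (t + h) - pois i t = h * pois_deriv i s"
    by auto
  \<comment> \<open>A second use of the mean value theorem compares the derivatives at \<open>s\<close> and \<open>t\<close>.\<close>
  have "\<exists>r>t. r < s \<and> pois_deriv i s - pois_deriv i t =
      (s - t) * ((case i of 0 \<Rightarrow> 0 | Suc l \<Rightarrow> pois_deriv l r) - pois_deriv i r)"
    by (rule MVT2[OF s(1)]) (rule DERIV_pois_deriv)
  then obtain r where r: "t < r" "pois_deriv i s - pois_deriv i t =
      (s - t) * ((case i of 0 \<Rightarrow> 0 | Suc l \<Rightarrow> pois_deriv l r) - pois_deriv i r)"
    by blast
  have "\<bar>(case i of 0 \<Rightarrow> 0 | Suc l \<Rightarrow> pois_deriv l r) - pois_deriv i r\<bar> \<le> 2"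
    using abs_pois_deriv_le[of r i] abs_pois_deriv_le[of r "i - 1"] r(1) assms(1) by (cases i) auto
  moreover have "\<bar>s - t\<bar> \<le> h"
    using s by simp
  ultimately have "\<bar>pois_deriv i s - pois_deriv i t\<bar> \<le> h * 2"
    unfolding r(2) abs_mult using assms(2) by (intro mult_mono) simp_all
  then have "h * \<bar>pois_deriv i s - pois_deriv i t\<bar> \<le> h * (h * 2)"
    using assms(2) by (intro mult_left_mono) auto
  moreover have "pois i (t + h) - pois i t - h * pois_deriv i t = h * (pois_deriv i s - pois_deriv i t)"
    using s(3) by (simp add: algebra_simps)
  ultimately show ?thesis
    using assms(2) by (simp add: abs_mult power2_eq_square mult.commute)
qed

text \<open>
  One step of the recursion replaces \<open>z i\<close> by \<open>(1 - h) z i + h z (i - 1)\<close>. This is a convex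
  combination, so it does not increase the maximal error, and each step adds at most
  \<open>4 k h^2\<close> from \<open>avg_recurrences\<close> and \<open>2 h^2\<close> from \<open>pois_euler_step\<close>.
\<close>

lemma avg_num_words_hit_near_pois:
  fixes k :: nat
  defines "h \<equiv> 1 / real CARD('a::finite) ^ k"
  assumes k: "1 \<le> k" and n: "m + k \<le> n"
  shows "\<bar>h * avg n (\<lambda>u::'a list. real (num_words_hit k m i ((!) u))) - pois i (real m * h)\<bar>
    \<le> real m * (6 * real k * h\<^sup>2)"
  using n
proof (induction m arbitrary: i)
  case 0
  have "pois i 0 = (if i = 0 then 1 else 0)"
    by (simp add: pois_def power_0_left)
  then show ?case
    by (simp add: num_words_hit_0 h_def)
next
  case (Suc m)
  define z where "z i = h * avg n (\<lambda>u::'a list. real (num_words_hit k m i ((!) u)))" for i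
  define q where "q i = avg n (\<lambda>u::'a list. of_bool (recurrences k m ((!) u) = i))" for i
  \<comment> \<open>The primed quantities belong to the index \<open>i - 1\<close>; they vanish for \<open>i = 0\<close>.\<close>
  define q' where "q' = (case i of 0 \<Rightarrow> 0 | Suc l \<Rightarrow> q l)"
  define z' where "z' = (case i of 0 \<Rightarrow> 0 | Suc l \<Rightarrow> z l)"
  define p' where "p' = (case i of 0 \<Rightarrow> 0 | Suc l \<Rightarrow> pois l (real m * h))"
  have h: "0 < h" "h \<le> 1"
    by (auto simp: h_def)
  have q: "\<bar>q i - z i\<bar> \<le> 2 * real k * h" for i
    using avg_recurrences[where 'a = 'a, of m k n i] Suc.prems k by (simp add: q_def z_def h_def)
  then have q'z': "\<bar>q' - z'\<bar> \<le> 2 * real k * h"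
    using h by (auto simp: q'_def z'_def split: nat.split)
  have IH: "\<bar>z i - pois i (real m * h)\<bar> \<le> real m * (6 * real k * h\<^sup>2)" for i
    using Suc by (simp add: z_def)
  then have z'p': "\<bar>z' - p'\<bar> \<le> real m * (6 * real k * h\<^sup>2)"
    using h by (auto simp: z'_def p'_def split: nat.split)
  have "avg n (\<lambda>u::'a list. of_bool (Suc (recurrences k m ((!) u)) = i)) = q'"
    by (cases i) (auto simp: q'_def q_def)
  then have "h * avg n (\<lambda>u::'a list. real (num_words_hit k (Suc m) i ((!) u))) = z i + h * (q' - q i)"
    unfolding num_words_hit_Suc avg_diff avg_add by (simp add: z_def q_def algebra_simps)
  moreover have "\<bar>h * (q' - q i) - h * (z' - z i)\<bar> \<le> 4 * real k * h\<^sup>2"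
  proof -
    have "\<bar>(q' - q i) - (z' - z i)\<bar> \<le> 4 * real k * h"
      using q[of i] q'z' by linarith
    then have "h * \<bar>(q' - q i) - (z' - z i)\<bar> \<le> h * (4 * real k * h)"
      using h by (intro mult_left_mono) auto
    moreover have "h * (q' - q i) - h * (z' - z i) = h * ((q' - q i) - (z' - z i))"
      by (simp add: algebra_simps)
    ultimately show ?thesis
      using h by (simp add: abs_mult power2_eq_square mult_ac)
  qed
  moreover have "\<bar>pois i (real (Suc m) * h) - pois i (real m * h) - h * (p' - pois i (real m * h))\<bar> \<le> 2 * h\<^sup>2"
  proof -
    have "real (Suc m) * h = real m * h + h"
      by (simp add: algebra_simps)
    then show ?thesis
      using pois_euler_step[of "real m * h" h i] h unfolding p'_def pois_deriv_def by simp
  qed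
  moreover have "2 * h\<^sup>2 \<le> 2 * real k * h\<^sup>2"
    using k by (intro mult_right_mono) auto
  moreover have "\<bar>(z i + h * (z' - z i)) - (pois i (real m * h) + h * (p' - pois i (real m * h)))\<bar>
      \<le> real m * (6 * real k * h\<^sup>2)"
  proof -
    have "(z i + h * (z' - z i)) - (pois i (real m * h) + h * (p' - pois i (real m * h))) =
        (1 - h) * (z i - pois i (real m * h)) + h * (z' - p')"
      by (simp add: algebra_simps)
    also have "\<bar>\<dots>\<bar> \<le> (1 - h) * (real m * (6 * real k * h\<^sup>2)) + h * (real m * (6 * real k * h\<^sup>2))"
      using h IH[of i] z'p'
      by (intro order_trans[OF abs_triangle_ineq] add_mono) (auto simp: abs_mult intro!: mult_left_mono)
    finally show ?thesis
      by (simp add: algebra_simps)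
  qed
  moreover have "real (Suc m) * (6 * real k * h\<^sup>2) =
      real m * (6 * real k * h\<^sup>2) + 4 * real k * h\<^sup>2 + 2 * real k * h\<^sup>2"
    by (simp add: algebra_simps)
  ultimately show ?case
    by linarith
qed

lemma num_words_hit_deviation_le:
  fixes k :: nat
  defines "h \<equiv> 1 / real CARD('a::finite) ^ k"
  assumes "0 < \<epsilon>" and mean: "\<bar>h * avg (m + k) (\<lambda>u::'a list. real (num_words_hit k m i ((!) u))) - c\<bar> \<le> \<epsilon> / 2"
  shows "avg (m + k) (\<lambda>u::'a list. of_bool (\<epsilon> < \<bar>h * real (num_words_hit k m i ((!) u)) - c\<bar>))
    \<le> real (m + k) * (h * (2 * real k))\<^sup>2 / (\<epsilon> / 2)\<^sup>2"
proof -
  let ?f = "\<lambda>u::'a list. h * real (num_words_hit k m i ((!) u))"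
  have "avg (m + k) (\<lambda>u::'a list. of_bool (\<epsilon> < \<bar>?f u - c\<bar>))
      \<le> avg (m + k) (\<lambda>u. of_bool (\<epsilon> / 2 \<le> \<bar>?f u - avg (m + k) ?f\<bar>))"
  proof (rule avg_mono)
    fix u
    have "\<epsilon> / 2 \<le> \<bar>?f u - avg (m + k) ?f\<bar>" if "\<epsilon> < \<bar>?f u - c\<bar>"
      using that mean unfolding avg_cmult by linarith
    then show "of_bool (\<epsilon> < \<bar>?f u - c\<bar>) \<le> (of_bool (\<epsilon> / 2 \<le> \<bar>?f u - avg (m + k) ?f\<bar>) :: real)"
      by simp
  qed
  also have "\<dots> \<le> real (m + k) * (h * (2 * real k))\<^sup>2 / (\<epsilon> / 2)\<^sup>2"
  proof (rule avg_deviation_le)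
    fix v w :: "'a list" and a a'
    have "\<bar>real (num_words_hit k m i ((!) (v @ a # w))) - real (num_words_hit k m i ((!) (v @ a' # w)))\<bar> \<le> 2 * real k"
      by (rule abs_num_words_hit_update_le[where p = "length v"]) (auto simp: nth_append nth_Cons')
    then have "h * \<bar>real (num_words_hit k m i ((!) (v @ a # w))) - real (num_words_hit k m i ((!) (v @ a' # w)))\<bar> \<le> h * (2 * real k)"
      by (intro mult_left_mono) (auto simp: h_def)
    moreover have "?f (v @ a # w) - ?f (v @ a' # w) =
        h * (real (num_words_hit k m i ((!) (v @ a # w))) - real (num_words_hit k m i ((!) (v @ a' # w))))"
      by (simp add: algebra_simps)
    ultimately show "\<bar>?f (v @ a # w) - ?f (v @ a' # w)\<bar> \<le> h * (2 * real k)"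
      by (simp add: abs_mult h_def)
  qed (use assms in simp)
  finally show ?thesis .
qed

lemma measure_num_words_hit_deviation:
  fixes P :: "real \<Rightarrow> bool" and k m i :: nat
  defines "E \<equiv> {x :: nat \<Rightarrow> 'a::finite. P (real (num_words_hit k m i x) / real CARD('a) ^ k)}"
  shows "E \<in> sets uniform_seq_measure"
    "measure uniform_seq_measure E =
      avg (m + k) (\<lambda>u::'a list. of_bool (P (1 / real CARD('a) ^ k * real (num_words_hit k m i ((!) u)))))"
proof -
  have "num_words_hit k m i ((!) (map x [0..<m + k])) = num_words_hit k m i x" for x :: "nat \<Rightarrow> 'a"
    by (rule num_words_hit_cong) auto
  then have E: "E = {x. P (1 / real CARD('a) ^ k * real (num_words_hit k m i ((!) (map x [0..<m + k]))))}"
    by (simp add: E_def)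
  show "E \<in> sets uniform_seq_measure"
    "measure uniform_seq_measure E =
      avg (m + k) (\<lambda>u::'a list. of_bool (P (1 / real CARD('a) ^ k * real (num_words_hit k m i ((!) u)))))"
    unfolding E by (fact measure_prefix)+
qed

text \<open>
  For large \<open>k\<close>, Chebyshev's inequality bounds the measure by \<open>2 ^ (- k)\<close> times a polynomial in \<open>k\<close>,
  and \<open>C\<close> takes care of the other \<open>k\<close>. The bound is stated in the form \<open>C / ((k + 1) (k + 2))\<close> because these terms telescope to \<open>C / (n + 1)\<close>, a computable bound on
  the tails of the series.
\<close>

lemma measure_num_words_hit_far_from_pois:
  fixes M :: "nat \<Rightarrow> nat"
  assumes b: "CARD('a::finite) \<ge> 2" and "0 < \<epsilon>"
    and M: "(\<lambda>k. real (M k) / real CARD('a) ^ k) \<longlonglongrightarrow> lam"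
  shows "\<exists>C. \<forall>k. measure uniform_seq_measure
      {x :: nat \<Rightarrow> 'a. \<epsilon> < \<bar>real (num_words_hit k (M k) i x) / real CARD('a) ^ k - pois i lam\<bar>}
    \<le> C / (real (k + 1) * real (k + 2))"
proof -
  interpret prob_space "uniform_seq_measure :: (nat \<Rightarrow> 'a) measure"
    by (rule prob_space_uniform_seq)
  define h where "h k = 1 / real CARD('a) ^ k" for k
  define E where "E k = {x :: nat \<Rightarrow> 'a. \<epsilon> < \<bar>real (num_words_hit k (M k) i x) / real CARD('a) ^ k - pois i lam\<bar>}" for k
  define mean where "mean k = h k * avg (M k + k) (\<lambda>u::'a list. real (num_words_hit k (M k) i ((!) u)))" for k
  have h: "0 < h k" "h k \<le> 1 / 2 ^ k" for k
  proof -
    show "0 < h k" by (simp add: h_def)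
    have "(2::real) ^ k \<le> real CARD('a) ^ k"
      using b by (intro power_mono) auto
    then show "h k \<le> 1 / 2 ^ k"
      by (simp add: h_def frac_le)
  qed
  obtain L where L: "\<And>k. real (M k) * h k \<le> L" "0 < L"
  proof -
    obtain L where "0 < L" "\<And>k. norm (real (M k) / real CARD('a) ^ k) \<le> L"
      using BseqE[OF convergent_imp_Bseq[OF convergentI[OF M]]] by metis
    then show ?thesis
      by (intro that[of L]) (auto simp: h_def)
  qed
  have "(\<lambda>k. mean k - pois i (real (M k) * h k)) \<longlonglongrightarrow> 0"
  proof (rule Lim_null_comparison)
    show "(\<lambda>k. L * (6 * real k) / 2 ^ k) \<longlonglongrightarrow> 0"
      by real_asymp
    show "\<forall>\<^sub>F k in sequentially. norm (mean k - pois i (real (M k) * h k)) \<le> L * (6 * real k) / 2 ^ k"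
      using eventually_ge_at_top[of 1]
    proof eventually_elim
      case (elim k)
      have "norm (mean k - pois i (real (M k) * h k)) \<le> real (M k) * (6 * real k * (h k)\<^sup>2)"
        using avg_num_words_hit_near_pois[where 'a = 'a and k = k and m = "M k" and n = "M k + k" and i = i] elim
        by (simp add: mean_def h_def)
      also have "\<dots> = (real (M k) * h k) * ((6 * real k) * h k)"
        by (simp add: power2_eq_square)
      also have "\<dots> \<le> L * ((6 * real k) * (1 / 2 ^ k))"
        using h[of k] L(1)[of k] L(2) by (intro mult_mono) (auto simp: less_imp_le)
      finally show ?case by simp
    qed
  qed
  moreover have "(\<lambda>k. pois i (real (M k) * h k)) \<longlonglongrightarrow> pois i lam"
    by (rule isCont_tendsto_compose[where g = "pois i", OF DERIV_isCont[OF DERIV_pois]])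
      (use M in \<open>simp add: h_def\<close>)
  ultimately have "mean \<longlonglongrightarrow> pois i lam"
    using tendsto_add by fastforce
  then have close: "\<forall>\<^sub>F k in sequentially. \<bar>mean k - pois i lam\<bar> \<le> \<epsilon> / 2"
    using tendstoD[of mean "pois i lam" sequentially "\<epsilon> / 2"] assms(2)
    by (auto simp: dist_real_def elim: eventually_mono)
  define a where "a k = real (k + 1) * real (k + 2) * prob (E k)" for k
  have "a \<longlonglongrightarrow> 0"
  proof (rule Lim_null_comparison)
    show "(\<lambda>k. real (k + 1) * real (k + 2) * ((L + real k) * (4 * real k ^ 2) / (\<epsilon> / 2)\<^sup>2 * (1 / 2 ^ k))) \<longlonglongrightarrow> 0"
      using assms(2) by real_asymp
    show "\<forall>\<^sub>F k in sequentially. norm (a k) \<le>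
        real (k + 1) * real (k + 2) * ((L + real k) * (4 * real k ^ 2) / (\<epsilon> / 2)\<^sup>2 * (1 / 2 ^ k))"
      using close
    proof eventually_elim
      case (elim k)
      have "prob (E k) = avg (M k + k) (\<lambda>u::'a list. of_bool (\<epsilon> < \<bar>h k * real (num_words_hit k (M k) i ((!) u)) - pois i lam\<bar>))"
        unfolding E_def h_def by (rule measure_num_words_hit_deviation)
      also have "\<dots> \<le> real (M k + k) * (h k * (2 * real k))\<^sup>2 / (\<epsilon> / 2)\<^sup>2"
        using num_words_hit_deviation_le[where 'a = 'a and \<epsilon> = \<epsilon> and k = k and m = "M k" and i = i and c = "pois i lam"] elim assms(2)
        by (simp add: mean_def h_def)
      also have "\<dots> = (real (M k) * h k + real k * h k) * (4 * real k ^ 2) / (\<epsilon> / 2)\<^sup>2 * h k"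
        by (simp add: power2_eq_square field_simps)
      also have "\<dots> \<le> (L + real k) * (4 * real k ^ 2) / (\<epsilon> / 2)\<^sup>2 * (1 / 2 ^ k)"
      proof (intro mult_mono divide_right_mono add_mono L)
        have "h k \<le> 1"
          using h(2)[of k] by (rule order_trans) simp
        then show "real k * h k \<le> real k"
          by (simp add: mult_left_le)
      qed (use h[of k] L in \<open>auto simp: less_imp_le\<close>)
      finally have "a k \<le> real (k + 1) * real (k + 2) *
          ((L + real k) * (4 * real k ^ 2) / (\<epsilon> / 2)\<^sup>2 * (1 / 2 ^ k))"
        unfolding a_def by (rule mult_left_mono) simp
      moreover have "0 \<le> a k"
        by (simp add: a_def)
      ultimately show ?case
        by (simp only: real_norm_def abs_of_nonneg)
    qed
  qed
  then obtain C where C: "\<And>k. norm (a k) \<le> C"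
    using BseqE[OF convergent_imp_Bseq[OF convergentI]] by metis
  have "prob (E k) \<le> C / (real (k + 1) * real (k + 2))" for k
  proof -
    have pos: "0 < real (k + 1) * real (k + 2)"
      by simp
    have "a k \<le> C"
      using C[of k] by (simp add: abs_le_iff)
    then show ?thesis
      unfolding pos_le_divide_eq[OF pos] a_def by (simp only: mult.commute)
  qed
  then show ?thesis
    unfolding E_def by blast
qed

section \<open>An effective Borel-Cantelli lemma\<close>

text \<open>
  The base-\<open>b\<close> digits of \<open>i\<close>, the least significant digit first. They serve to enumerate all
  finite prefixes of sequences.
\<close>

definition digit :: "nat \<Rightarrow> nat \<Rightarrow> nat \<Rightarrow> nat" where
  "digit b i t = i div b ^ t mod b"

lemma digit_less: "0 < b \<Longrightarrow> digit b i t < b"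
  by (simp add: digit_def)

text \<open>
  The number \<open>i\<close> exceeds \<open>l\<close> because it has a nonzero part above the \<open>l\<close> digits prescribed by \<open>d\<close>.
\<close>

lemma exists_digits:
  assumes "2 \<le> b" "\<And>t. d t < b"
  shows "\<exists>i>l. \<forall>t<l. digit b i t = d t"
  using assms(2)
proof (induction l arbitrary: d)
  case 0
  then show ?case by auto
next
  case (Suc l)
  obtain i where i: "i > l" "\<forall>t<l. digit b i t = d (Suc t)"
    using Suc.IH[of "\<lambda>t. d (Suc t)"] Suc.prems by blast
  have "2 * i \<le> b * i"
    using assms(1) by simp
  then have "Suc l < d 0 + b * i"
    using i(1) by linarith
  moreover have "digit b (d 0 + b * i) t = d t" if "t < Suc l" for t
  proof (cases t)
    case 0
    then show ?thesis
      using Suc.prems[of 0] by (simp add: digit_def)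
  next
    case (Suc t')
    have "(d 0 + b * i) div b ^ t = (d 0 + b * i) div b div b ^ t'"
      by (simp add: Suc div_mult2_eq)
    also have "(d 0 + b * i) div b = i"
      using assms(1) Suc.prems[of 0] by simp
    finally show ?thesis
      using i(2) that Suc by (simp add: digit_def)
  qed
  ultimately show ?case by blast
qed

lemma rec_fun_digit:
  assumes "rec_fun n i" "rec_fun n t"
  shows "rec_fun n (\<lambda>xs. digit b (i xs) (t xs))"
  unfolding digit_def by (intro rec_fun_mod rec_fun_div rec_fun_power rec_fun_const assms)

text \<open>
  The sequence whose symbols have the digits of \<open>i\<close> as their numbers. Every finite prefix
  belongs to such a sequence.
\<close>

definition coded_seq :: "nat \<Rightarrow> nat \<Rightarrow> 'a::finite" where
  "coded_seq i t = from_nat_into UNIV (digit CARD('a) i t)"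

lemma to_nat_on_coded_seq: "to_nat_on UNIV (coded_seq i t :: 'a::finite) = digit CARD('a) i t"
proof -
  have "digit CARD('a) i t \<in> to_nat_on (UNIV :: 'a set) ` UNIV"
    using bij_betw_imp_surj_on[OF to_nat_on_finite[of "UNIV :: 'a set"]] digit_less[of "CARD('a)" i t]
    by simp
  then show ?thesis
    unfolding coded_seq_def by (rule to_nat_on_from_nat_into)
qed

lemma exists_coded_seq:
  fixes x :: "nat \<Rightarrow> 'a::finite"
  assumes "2 \<le> CARD('a)"
  shows "\<exists>i>l. \<forall>t<l. coded_seq i t = x t"
proof -
  have "to_nat_on (UNIV :: 'a set) a < CARD('a)" for a
    using bij_betwE[OF to_nat_on_finite[of "UNIV :: 'a set"]] by simp
  from exists_digits[OF assms, of "\<lambda>t. to_nat_on (UNIV :: 'a set) (x t)", OF this]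
  obtain i where "i > l" "\<forall>t<l. digit CARD('a) i t = to_nat_on (UNIV :: 'a set) (x t)"
    by blast
  then show ?thesis
    by (intro exI[of _ i]) (simp add: coded_seq_def)
qed

lemma computable1I: "rec_fun 1 (\<lambda>xs. f (xs ! 0)) \<Longrightarrow> computable1 f"
  unfolding computable1_def rec_fun_def by (metis One_nat_def length_Cons list.size(3) nth_Cons_0)

lemma computable2I: "rec_fun 2 (\<lambda>xs. f (xs ! 0) (xs ! 1)) \<Longrightarrow> computable2 f"
proof -
  assume "rec_fun 2 (\<lambda>xs. f (xs ! 0) (xs ! 1))"
  then obtain F where "recursive 2 F" "\<And>xs. length xs = 2 \<Longrightarrow> f (xs ! 0) (xs ! 1) = F xs"
    unfolding rec_fun_def by blast
  moreover from this(2)[of "[m, n]" for m n] have "f m n = F [m, n]" for m n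
    by simp
  ultimately show ?thesis
    unfolding computable2_def by blast
qed

lemma computable_rat_seq_divide_Suc: "computable_rat_seq (\<lambda>n. of_nat c / of_nat (Suc n))"
  unfolding computable_rat_seq_def
  by (rule exI[of _ "\<lambda>_. 0"], rule exI[of _ "\<lambda>_. c"], rule exI[of _ Suc])
    (auto intro!: computable1I rec_fun_const rec_fun_Suc rec_fun_nth simp del: of_nat_Suc)

lemma sums_inverse_consecutive: "(\<lambda>j. c / (real (n + j + 1) * real (n + j + 2))) sums (c / real (n + 1))"
proof -
  have "(\<lambda>j. c / real (n + j + 1)) \<longlonglongrightarrow> 0"
    by real_asymp
  from telescope_sums'[OF this]
  have "(\<lambda>j. c / real (n + j + 1) - c / real (n + Suc j + 1)) sums (c / real (n + 1))"
    by simp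
  moreover have "c / real (n + j + 1) - c / real (n + Suc j + 1) = c / (real (n + j + 1) * real (n + j + 2))" for j
  proof -
    have "c / p - c / (p + 1) = c / (p * (p + 1))" if "0 < p" for p :: real
      using that by (simp add: field_simps)
    from this[of "real (n + j + 1)"] show ?thesis
      by (simp add: add_ac)
  qed
  ultimately show ?thesis by simp
qed

text \<open>
  An effective form of the first Borel-Cantelli lemma, for events \<open>E k\<close> that are decidable from the first
  \<open>L k\<close> symbols. The test set \<open>U n\<close> should be the union of the \<open>E k\<close> with \<open>n \<le> k\<close>, whose measure is
  at most \<open>C / (n + 1)\<close>. To enumerate its cylinders, the number \<open>i\<close> yields the prefix of length \<open>L k\<close>
  of \<open>coded_seq i\<close>, where \<open>k\<close> is the least number with \<open>n \<le> k\<close> and \<open>coded_seq i \<in> E k\<close>; the search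
  stops when \<open>k\<close> exceeds \<open>i\<close>. If the search fails, the enumeration has to name some cylinder all the
  same, as a union of cylinders is never empty. It takes that of a constant word of length \<open>n\<close>,
  which adds only \<open>b ^ (- n)\<close> to the measure.
\<close>

lemma martin_loef_random_eventually_notin:
  fixes x :: "nat \<Rightarrow> 'a::finite" and E :: "nat \<Rightarrow> (nat \<Rightarrow> 'a) set"
  assumes b: "CARD('a) \<ge> 2" and x: "martin_loef_random x"
    and L: "rec_fun 1 (\<lambda>xs. L (xs ! 0))" "mono L" "\<And>k. k \<le> L k"
    and E: "rec_pred 2 (\<lambda>xs. coded_seq (xs ! 1) \<in> E (xs ! 0))"
    and prefix: "\<And>k y z. y \<in> E k \<Longrightarrow> (\<And>t. t < L k \<Longrightarrow> y t = z t) \<Longrightarrow> z \<in> E k"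
    and sets: "\<And>k. E k \<in> sets uniform_seq_measure"
    and meas: "\<And>k. measure uniform_seq_measure (E k) \<le> C / (real (k + 1) * real (k + 2))"
  shows "\<forall>\<^sub>F k in sequentially. x \<notin> E k"
proof -
  interpret prob_space "uniform_seq_measure :: (nat \<Rightarrow> 'a) measure"
    by (rule prob_space_uniform_seq)
  let ?b = "CARD('a)"
  let ?a0 = "from_nat_into UNIV 0 :: 'a"
  \<comment> \<open>The value of the search exceeds \<open>i\<close> exactly if the search fails.\<close>
  define K where "K n i = (LEAST k. n \<le> k \<and> coded_seq i \<in> E k \<or> i < k)" for n i
  define w where "w n i = (if K n i \<le> i then map (coded_seq i) [0..<L (K n i)] else replicate n ?a0)" for n i
  define U where "U n = (\<Union>i\<in>{1..}. cylinder (w n i))" for n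
  have K: "n \<le> K n i \<and> coded_seq i \<in> E (K n i) \<or> i < K n i" for n i
    unfolding K_def by (rule LeastI[of _ "Suc i"]) simp
  have K_rec: "rec_fun 2 (\<lambda>xs. K (xs ! 0) (xs ! 1))"
  proof -
    let ?P = "\<lambda>ys. \<not> ys ! 0 < ys ! 1 \<and> coded_seq (ys ! 2) \<in> E (ys ! 0) \<or> ys ! 2 < ys ! 0"
    have "rec_pred 3 (\<lambda>ys. coded_seq (ys ! 2) \<in> E (ys ! 0))"
      by (rule rec_fun_comp2[where f = "\<lambda>k i. of_bool (coded_seq i \<in> E k)", OF E])
        (auto intro: rec_fun_nth)
    then have "rec_pred (Suc 2) (\<lambda>ys. \<not> ?P ys)"
      by (intro rec_pred_not rec_pred_disj rec_pred_conj rec_pred_less rec_fun_nth) auto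
    then have "rec_fun 2 (\<lambda>xs. LEAST k. of_bool (\<not> ?P (k # xs)) = (0::nat))"
      by (rule rec_fun_Least) (auto simp: numeral_2_eq_2 intro: exI[of _ "Suc i" for i])
    then show ?thesis
      unfolding K_def by (rule rec_fun_cong) (simp add: not_less not_le)
  qed
  have "computable_word_fun w"
    unfolding computable_word_fun_def
  proof (rule computable2I)
    let ?c = "\<lambda>ys. if \<not> ys ! 2 < K (ys ! 1) (ys ! 2) then digit ?b (ys ! 2) (ys ! 0) else 0"
    let ?l = "\<lambda>xs. if \<not> xs ! 1 < K (xs ! 0) (xs ! 1) then L (K (xs ! 0) (xs ! 1)) else xs ! 0"
    have "rec_fun (Suc 2) ?c"
      by (intro rec_fun_If rec_pred_not rec_pred_less rec_fun_digit rec_fun_const rec_fun_nth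
          rec_fun_comp2[OF K_rec]) auto
    moreover have "rec_fun 2 ?l"
      by (intro rec_fun_If rec_pred_not rec_pred_less rec_fun_nth K_rec rec_fun_comp1[OF L(1)]) auto
    ultimately have "rec_fun 2 (\<lambda>xs. list_encode (map (\<lambda>t. ?c (t # xs)) [0..<?l xs]))"
      by (rule rec_fun_list_encode)
    moreover have "to_nat_on UNIV ?a0 = 0"
      using to_nat_on_coded_seq[of 0 0, where 'a = 'a] by (simp add: coded_seq_def digit_def)
    then have "word_code (w n i) = list_encode (map (\<lambda>t. ?c (t # n # i # [])) [0..<?l [n, i]])" for n i
      by (simp add: word_code_def w_def not_less comp_def to_nat_on_coded_seq map_replicate_const)
    ultimately show "rec_fun 2 (\<lambda>xs. word_code (w (xs ! 0) (xs ! 1)))"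
      by (elim rec_fun_cong) (simp add: numeral_2_eq_2)
  qed
  moreover have "w n i \<noteq> []" if "n \<ge> 1" for n i
    using K[of n i] L(3)[of "K n i"] that by (auto simp: w_def)
  ultimately have "uniformly_computable U"
    unfolding uniformly_computable_def U_def by blast

  have E_sub: "x \<in> U n" if "1 \<le> n" "n \<le> k" "x \<in> E k" for n k and x :: "nat \<Rightarrow> 'a"
  proof -
    define k0 where "k0 = (LEAST k. n \<le> k \<and> x \<in> E k)"
    have k0: "n \<le> k0" "x \<in> E k0"
      using LeastI[of "\<lambda>k. n \<le> k \<and> x \<in> E k" k] that by (auto simp: k0_def)
    have min: "x \<notin> E k'" if "n \<le> k'" "k' < k0" for k'
      using not_less_Least[of k' "\<lambda>k. n \<le> k \<and> x \<in> E k"] that by (auto simp: k0_def)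
    \<comment> \<open>As \<open>i\<close> exceeds \<open>L k0\<close>, which is at least \<open>k0\<close>, the search for \<open>i\<close> gets as far as \<open>k0\<close>.\<close>
    obtain i where i: "i > L k0" "\<And>t. t < L k0 \<Longrightarrow> coded_seq i t = x t"
      using exists_coded_seq[OF b] by metis
    have "K n i = k0"
      unfolding K_def
    proof (rule Least_equality)
      have "coded_seq i \<in> E k0"
        using k0(2) by (rule prefix) (simp add: i(2))
      then show "n \<le> k0 \<and> coded_seq i \<in> E k0 \<or> i < k0"
        using k0 by blast
    next
      fix k' assume k': "n \<le> k' \<and> coded_seq i \<in> E k' \<or> i < k'"
      show "k0 \<le> k'"
      proof (rule ccontr)
        assume "\<not> k0 \<le> k'"
        then have less: "k' < k0" by simp
        \<comment> \<open>The sequence \<open>coded_seq i\<close> agrees with \<open>x\<close> also on the shorter prefix that decides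
          \<open>E k'\<close>, so the search does not stop before \<open>k0\<close>.\<close>
        then have "L k' \<le> L k0"
          by (intro monoD[OF L(2)]) simp
        then have "coded_seq i \<in> E k' \<Longrightarrow> x \<in> E k'"
          using i(2) by (elim prefix) auto
        then show False
          using k' min[of k'] less i(1) L(3)[of k0] by auto
      qed
    qed
    then have "w n i = map (coded_seq i) [0..<L k0]"
      using i(1) L(3)[of k0] by (simp add: w_def)
    then have "x \<in> cylinder (w n i)"
      using i(2) by (simp add: cylinder_altdef)
    then show ?thesis
      using i(1) unfolding U_def by auto
  qed

  have U_sub: "U n \<subseteq> (\<Union>j. E (n + j)) \<union> cylinder (replicate n ?a0)" for n
  proof
    fix y assume "y \<in> U n"
    then obtain i where y: "y \<in> cylinder (w n i)"
      by (auto simp: U_def)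
    show "y \<in> (\<Union>j. E (n + j)) \<union> cylinder (replicate n ?a0)"
    proof (cases "K n i \<le> i")
      case True
      then have nK: "n \<le> K n i" "coded_seq i \<in> E (K n i)"
        using K[of n i] by auto
      have "y \<in> E (K n i)"
        by (rule prefix[OF nK(2)]) (use y True in \<open>simp add: w_def cylinder_altdef\<close>)
      then have "y \<in> E (n + (K n i - n))"
        using nK(1) by simp
      then show ?thesis by blast
    qed (use y in \<open>simp add: w_def\<close>)
  qed
  have meas_U: "prob (U n) \<le> (C + 1) / real (Suc n)" for n
  proof -
    let ?s = "\<lambda>j. C / (real (n + j + 1) * real (n + j + 2))"
    have summable: "summable ?s" and suminf: "suminf ?s = C / real (n + 1)"
      using sums_inverse_consecutive[of C n] by (auto simp: sums_iff)
    have summable_E: "summable (\<lambda>j. prob (E (n + j)))"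
      by (rule summable_comparison_test'[OF summable, of 0])
        (simp only: real_norm_def abs_of_nonneg[OF measure_nonneg] meas)
    have "prob (\<Union>j. E (n + j)) \<le> (\<Sum>j. prob (E (n + j)))"
      by (rule finite_measure_subadditive_countably) (use sets summable_E in auto)
    also have "\<dots> \<le> suminf ?s"
      by (rule suminf_le[OF _ summable_E summable]) (rule meas)
    finally have 1: "prob (\<Union>j. E (n + j)) \<le> C / real (n + 1)"
      by (simp only: suminf)
    have "Suc n \<le> 2 ^ n"
      by (simp add: Suc_leI)
    then have "Suc n \<le> ?b ^ n"
      using power_mono[OF b, of n] by linarith
    then have "real (Suc n) \<le> real ?b ^ n"
      by (metis of_nat_le_iff of_nat_power)
    then have 2: "prob (cylinder (replicate n ?a0)) \<le> 1 / real (n + 1)"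
      by (simp add: measure_cylinder frac_le)
    have "prob (U n) \<le> prob ((\<Union>j. E (n + j)) \<union> cylinder (replicate n ?a0))"
      by (rule finite_measure_mono[OF U_sub]) (use sets sets_cylinder in auto)
    also have "\<dots> \<le> prob (\<Union>j. E (n + j)) + prob (cylinder (replicate n ?a0))"
      by (rule measure_Un_le) (use sets sets_cylinder in auto)
    finally show ?thesis
      using 1 2 by (simp add: add_divide_distrib)
  qed
  obtain c :: nat where c: "C + 1 \<le> real c"
    using real_arch_simple by blast
  define r :: "nat \<Rightarrow> rat" where "r n = of_nat c / of_nat (Suc n)" for n
  have r: "real_of_rat (r n) = real c / real (Suc n)" for n
    by (simp add: r_def of_rat_divide del: of_nat_Suc)
  have "martin_loef_test U"
    unfolding martin_loef_test_def
  proof (intro conjI exI[of _ r])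
    show "computable_rat_seq r"
      unfolding r_def by (rule computable_rat_seq_divide_Suc)
    show "(\<lambda>n. real_of_rat (r n)) \<longlonglongrightarrow> 0"
      unfolding r by real_asymp
    show "\<forall>n\<ge>1. prob (U n) \<le> real_of_rat (r n)"
      unfolding r using meas_U c by (meson divide_right_mono of_nat_0_le_iff order_trans)
  qed fact
  then obtain n where "n \<ge> 1" "x \<notin> U n"
    using x unfolding martin_loef_random_def by blast
  then show ?thesis
    using E_sub unfolding eventually_sequentially by blast
qed

section \<open>Poisson genericity of random sequences\<close>

text \<open>
  This expresses a count over words by counts over positions, which avoids coding words of
  length \<open>k\<close> when it is computed.
\<close>

lemma num_words_hit_eq_recurrences:
  fixes x :: "nat \<Rightarrow> 'a::finite"
  shows "num_words_hit k m i x = (if i = 0 then CARD('a) ^ k else 0) + card {j. j < m \<and> Suc (recurrences k j x) = i}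
    - card {j. j < m \<and> recurrences k j x = i}"
proof -
  have card_Suc: "card {j. j < Suc m \<and> P j} = card {j. j < m \<and> P j} + of_bool (P m)" for P :: "nat \<Rightarrow> bool" and m
  proof -
    have "{j. j < Suc m \<and> P j} = {j. j < m \<and> P j} \<union> (if P m then {m} else {})"
      by (auto simp: less_Suc_eq)
    then show ?thesis by simp
  qed
  have "real (num_words_hit k m i x) + real (card {j. j < m \<and> recurrences k j x = i}) =
      real (if i = 0 then CARD('a) ^ k else 0) + real (card {j. j < m \<and> Suc (recurrences k j x) = i})"
  proof (induction m)
    case (Suc m)
    then show ?case
      unfolding num_words_hit_Suc card_Suc by simp
  qed (simp add: num_words_hit_0)
  then show ?thesis by linarith
qed

lemma recurrences_coded_seq:
  "recurrences k m (coded_seq n :: nat \<Rightarrow> 'a::finite) =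
    card {j. j < m \<and> (\<forall>t<k. digit CARD('a) n (j + t) = digit CARD('a) n (m + t))}"
proof -
  have "(coded_seq n s :: 'a) = coded_seq n t \<longleftrightarrow> digit CARD('a) n s = digit CARD('a) n t" for s t
    by (metis to_nat_on_coded_seq coded_seq_def)
  then show ?thesis
    unfolding recurrences_def occurrences_def by simp
qed

lemma rec_fun_recurrences:
  "rec_fun 3 (\<lambda>xs. recurrences (xs ! 0) (xs ! 1) (coded_seq (xs ! 2) :: nat \<Rightarrow> 'a::finite))"
proof -
  let ?b = "CARD('a)"
  let ?Q = "\<lambda>zs. digit ?b (zs ! 4) (zs ! 1 + zs ! 0) = digit ?b (zs ! 4) (zs ! 3 + zs ! 0)"
  let ?P = "\<lambda>ys. \<forall>t<ys ! 1. ?Q (t # ys)"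
  have "rec_pred (Suc 4) ?Q"
    by (intro rec_pred_eq rec_fun_digit rec_fun_add rec_fun_nth) auto
  then have "rec_pred 4 ?P"
    by (rule rec_pred_all) (rule rec_fun_nth, simp)
  then have "rec_pred (Suc 3) ?P"
    by simp
  then have "rec_fun 3 (\<lambda>xs. card {j. j < xs ! 1 \<and> ?P (j # xs)})"
    by (rule rec_fun_card) (rule rec_fun_nth, simp)
  then show ?thesis
    unfolding recurrences_coded_seq by (rule rec_fun_cong) (simp add: eval_nat_numeral)
qed

lemma rec_fun_num_words_hit:
  assumes M: "rec_fun 1 (\<lambda>xs. M (xs ! 0))"
  shows "rec_fun 2 (\<lambda>xs. num_words_hit (xs ! 0) (M (xs ! 0)) i (coded_seq (xs ! 1) :: nat \<Rightarrow> 'a::finite))"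
proof -
  let ?R = "\<lambda>ys. recurrences (ys ! 1) (ys ! 0) (coded_seq (ys ! 2) :: nat \<Rightarrow> 'a)"
  have R: "rec_fun (Suc 2) ?R"
    by (rule rec_fun_comp3[where f = "\<lambda>k m i. recurrences k m (coded_seq i :: nat \<Rightarrow> 'a)", OF rec_fun_recurrences])
      (auto intro: rec_fun_nth)
  have M': "rec_fun 2 (\<lambda>xs. M (xs ! 0))"
    by (rule rec_fun_comp1[OF M]) (simp add: rec_fun_nth)
  have pow: "rec_fun 2 (\<lambda>xs. if i = 0 then CARD('a) ^ (xs ! 0) else 0)"
    by (cases "i = 0") (simp_all add: rec_fun_power rec_fun_nth rec_fun_const)
  have "rec_pred (Suc 2) (\<lambda>ys. Suc (?R ys) = i)" "rec_pred (Suc 2) (\<lambda>ys. ?R ys = i)"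
    by (rule rec_pred_eq[OF rec_fun_Suc[OF R] rec_fun_const] rec_pred_eq[OF R rec_fun_const])+
  then have "rec_fun 2 (\<lambda>xs. (if i = 0 then CARD('a) ^ (xs ! 0) else 0)
      + card {j. j < M (xs ! 0) \<and> Suc (?R (j # xs)) = i} - card {j. j < M (xs ! 0) \<and> ?R (j # xs) = i})"
    by (intro rec_fun_diff[OF rec_fun_add[OF pow rec_fun_card[OF _ M']] rec_fun_card[OF _ M']])
  then show ?thesis
    unfolding num_words_hit_eq_recurrences by (rule rec_fun_cong) (simp add: numeral_2_eq_2)
qed

lemma Z_eq_num_words_hit:
  fixes x :: "nat \<Rightarrow> 'a::finite"
  assumes "0 \<le> lam"
  shows "Z lam i k x = real (num_words_hit k (nat \<lfloor>lam * real CARD('a) ^ k\<rfloor>) i x) / real CARD('a) ^ k"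
proof -
  let ?M = "nat \<lfloor>lam * real CARD('a) ^ k\<rfloor>"
  have "real j \<le> lam * real (CARD('a) ^ k) \<longleftrightarrow> j \<le> ?M" for j
  proof -
    have "0 \<le> lam * real CARD('a) ^ k"
      using assms by simp
    then have "0 \<le> \<lfloor>lam * real CARD('a) ^ k\<rfloor>"
      by (simp only: zero_le_floor)
    from le_nat_iff[OF this] show ?thesis
      by (simp only: le_floor_iff of_int_of_nat_eq of_nat_power)
  qed
  then have J: "{j. 1 \<le> j \<and> real j \<le> lam * real (CARD('a) ^ k)} = Suc ` {..<?M}"
    unfolding image_Suc_lessThan atLeastAtMost_def atLeast_def atMost_def by blast
  have sum: "(\<Sum>j\<in>Suc ` {..<?M}. occurs_at j x w) = occurrences k ?M x ((!) w)" if w: "length w = k" for w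
  proof -
    have "block x (Suc j) k = w \<longleftrightarrow> (\<forall>t<k. x (j + t) = w ! t)" for j
      using w by (simp add: block_def list_eq_iff_nth_eq del: upt_Suc)
    then have "occurs_at (Suc j) x w = of_bool (\<forall>t<k. x (j + t) = w ! t)" for j
      using w by (simp add: occurs_at_def)
    then have "(\<Sum>j\<in>Suc ` {..<?M}. occurs_at j x w) = (\<Sum>j<?M. of_bool (\<forall>t<k. x (j + t) = w ! t))"
      by (simp only: sum.reindex[OF inj_on_subset[OF inj_Suc subset_UNIV]] o_def)
    also have "\<dots> = card ({..<?M} \<inter> {j. \<forall>t<k. x (j + t) = w ! t})"
      by (simp only: sum_of_bool_eq finite_lessThan of_nat_id)
    also have "{..<?M} \<inter> {j. \<forall>t<k. x (j + t) = w ! t} = {j. j < ?M \<and> (\<forall>t<k. x (j + t) = w ! t)}"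
      by blast
    finally show ?thesis
      by (simp only: occurrences_def)
  qed
  have "{w. length w = k \<and> (\<Sum>j\<in>Suc ` {..<?M}. occurs_at j x w) = i}
      = {w. length w = k \<and> occurrences k ?M x ((!) w) = i}"
    by (rule Collect_cong, rule conj_cong[OF refl]) (simp only: sum)
  then show ?thesis
    unfolding Z_def J num_words_hit_def by simp
qed

lemma floor_mult_power_asymp:
  fixes b :: nat
  assumes "b \<ge> 2" "0 \<le> lam"
  shows "(\<lambda>k. real (nat \<lfloor>lam * real b ^ k\<rfloor>) / real b ^ k) \<longlonglongrightarrow> lam"
proof (rule tendsto_sandwich)
  have "(\<lambda>k. (1 / real b) ^ k) \<longlonglongrightarrow> 0"
    using assms by (intro LIMSEQ_power_zero) simp
  then show "(\<lambda>k. lam - (1 / real b) ^ k) \<longlonglongrightarrow> lam"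
    using tendsto_diff[OF tendsto_const[of lam]] by fastforce
  have fl: "lam * real b ^ k - 1 \<le> real (nat \<lfloor>lam * real b ^ k\<rfloor>)" "real (nat \<lfloor>lam * real b ^ k\<rfloor>) \<le> lam * real b ^ k" for k
  proof -
    have "0 \<le> lam * real b ^ k"
      using assms by simp
    then show "lam * real b ^ k - 1 \<le> real (nat \<lfloor>lam * real b ^ k\<rfloor>)" "real (nat \<lfloor>lam * real b ^ k\<rfloor>) \<le> lam * real b ^ k"
      by linarith+
  qed
  have pos: "0 < real b ^ k" for k
    using assms by simp
  show "\<forall>\<^sub>F k in sequentially. lam - (1 / real b) ^ k \<le> real (nat \<lfloor>lam * real b ^ k\<rfloor>) / real b ^ k"
  proof (intro always_eventually allI)
    fix k
    have "lam - (1 / real b) ^ k = (lam * real b ^ k - 1) / real b ^ k"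
      using assms by (simp add: diff_divide_distrib power_one_over)
    also have "\<dots> \<le> real (nat \<lfloor>lam * real b ^ k\<rfloor>) / real b ^ k"
      by (intro divide_right_mono fl) simp
    finally show "lam - (1 / real b) ^ k \<le> real (nat \<lfloor>lam * real b ^ k\<rfloor>) / real b ^ k" .
  qed
  show "\<forall>\<^sub>F k in sequentially. real (nat \<lfloor>lam * real b ^ k\<rfloor>) / real b ^ k \<le> lam"
    unfolding pos_divide_le_eq[OF pos] by (intro always_eventually allI fl)
qed simp

text \<open>
  The real number \<open>pois i lam\<close> is replaced by the fraction \<open>s / T\<close> at most \<open>1 / T\<close> below it. Then the
  event \<open>E k\<close>, that \<open>T\<close> times the proportion differs from \<open>s\<close> by more than \<open>2\<close>, is an inequality
  between natural numbers and hence decidable, and it implies a deviation from \<open>pois i lam\<close> by more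
  than \<open>1 / T\<close>. Outside of \<open>E k\<close> the deviation is at most \<open>3 / T\<close>.
\<close>

lemma martin_loef_random_near_pois:
  fixes x :: "nat \<Rightarrow> 'a::finite" and p q T :: nat
  assumes b: "CARD('a) \<ge> 2" and x: "martin_loef_random x" and T: "0 < T"
  defines "lam \<equiv> real p / real q"
  shows "\<forall>\<^sub>F k in sequentially. \<bar>Z lam i k x - pois i lam\<bar> \<le> 3 / real T"
proof -
  interpret prob_space "uniform_seq_measure :: (nat \<Rightarrow> 'a) measure"
    by (rule prob_space_uniform_seq)
  let ?b = "CARD('a)"
  have lam: "0 \<le> lam"
    by (simp add: lam_def)
  have scale: "\<bar>real T * a - real T * c\<bar> = real T * \<bar>a - c\<bar>" for a c
    by (simp only: right_diff_distrib[symmetric] abs_mult abs_of_nat)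
  define M where "M k = p * ?b ^ k div q" for k
  define s where "s = nat \<lfloor>real T * pois i lam\<rfloor>"
  define E where "E k = {x :: nat \<Rightarrow> 'a. num_words_hit k (M k) i x * T + 2 * ?b ^ k < s * ?b ^ k \<or>
      (s + 2) * ?b ^ k < num_words_hit k (M k) i x * T}" for k
  define F where "F k = {x :: nat \<Rightarrow> 'a. 1 / real T < \<bar>real (num_words_hit k (M k) i x) / real ?b ^ k - pois i lam\<bar>}" for k
  have M_floor: "M k = nat \<lfloor>lam * real ?b ^ k\<rfloor>" for k
  proof -
    have "lam * real ?b ^ k = real (p * ?b ^ k) / real q"
      by (simp add: lam_def)
    then show ?thesis
      unfolding M_def by (simp only: floor_divide_of_nat_eq nat_int)
  qed
  have s: "real s \<le> real T * pois i lam" "real T * pois i lam < real s + 1"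
  proof -
    have "0 \<le> real T * pois i lam"
      using pois_nonneg[OF lam] by simp
    then show "real s \<le> real T * pois i lam" "real T * pois i lam < real s + 1"
      unfolding s_def by linarith+
  qed
  have E_iff: "x \<in> E k \<longleftrightarrow> real T * (real (num_words_hit k (M k) i x) / real ?b ^ k) < real s - 2 \<or>
      real s + 2 < real T * (real (num_words_hit k (M k) i x) / real ?b ^ k)" for x k
  proof -
    define B where "B = real ?b ^ k"
    define A where "A = real (num_words_hit k (M k) i x)"
    have B: "0 < B" by (simp add: B_def)
    have "x \<in> E k \<longleftrightarrow> A * real T + 2 * B < real s * B \<or> (real s + 2) * B < A * real T"
      unfolding E_def A_def B_def mem_Collect_eq
      by (simp only: of_nat_less_iff[where 'a = real, symmetric] of_nat_add of_nat_mult of_nat_power of_nat_numeral)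
    also have "A * real T + 2 * B < real s * B \<longleftrightarrow> real T * (A / B) < real s - 2"
      using B by (simp add: field_simps)
    also have "(real s + 2) * B < A * real T \<longleftrightarrow> real s + 2 < real T * (A / B)"
      using B by (simp add: field_simps)
    finally show ?thesis
      unfolding A_def B_def .
  qed
  obtain C where C: "\<And>k. prob (F k) \<le> C / (real (k + 1) * real (k + 2))"
  proof -
    have "(\<lambda>k. real (M k) / real ?b ^ k) \<longlonglongrightarrow> lam"
      unfolding M_floor by (rule floor_mult_power_asymp[OF b lam])
    moreover have "0 < 1 / real T"
      using T by simp
    ultimately have "\<exists>C. \<forall>k. prob (F k) \<le> C / (real (k + 1) * real (k + 2))"
      unfolding F_def by (intro measure_num_words_hit_far_from_pois b)
    then show ?thesis
      using that by blast
  qed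
  have "E k \<subseteq> F k" for k
  proof
    fix y assume "y \<in> E k"
    then have "1 < \<bar>real T * (real (num_words_hit k (M k) i y) / real ?b ^ k) - real T * pois i lam\<bar>"
      unfolding E_iff using s by linarith
    also have "\<dots> = real T * \<bar>real (num_words_hit k (M k) i y) / real ?b ^ k - pois i lam\<bar>"
      by (rule scale)
    finally show "y \<in> F k"
      using T by (simp add: F_def divide_less_eq mult.commute)
  qed
  moreover have "F k \<in> events" for k
    unfolding F_def by (rule measure_num_words_hit_deviation)
  ultimately have meas: "prob (E k) \<le> C / (real (k + 1) * real (k + 2))" for k
    by (rule order_trans[OF finite_measure_mono C])
  have sets: "E k \<in> events" for k
  proof -
    have "E k = {x. real T * (real (num_words_hit k (M k) i x) / real ?b ^ k) < real s - 2 \<or>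
        real s + 2 < real T * (real (num_words_hit k (M k) i x) / real ?b ^ k)}"
      using E_iff by blast
    then show ?thesis
      using measure_num_words_hit_deviation(1)[of "\<lambda>z. real T * z < real s - 2 \<or> real s + 2 < real T * z"] by simp
  qed
  have M_rec: "rec_fun 1 (\<lambda>xs. M (xs ! 0))"
    unfolding M_def by (intro rec_fun_div rec_fun_mult rec_fun_power rec_fun_const rec_fun_nth) simp
  have "\<forall>\<^sub>F k in sequentially. x \<notin> E k"
  proof (rule martin_loef_random_eventually_notin[OF b x _ _ _ _ _ sets meas])
    show "rec_fun 1 (\<lambda>xs. M (xs ! 0) + xs ! 0)"
      by (intro rec_fun_add M_rec rec_fun_nth) simp
    show "mono (\<lambda>k. M k + k)"
      unfolding M_def by (intro monoI add_mono div_le_mono mult_le_mono power_increasing) auto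
    show "rec_pred 2 (\<lambda>xs. coded_seq (xs ! 1) \<in> E (xs ! 0))"
      unfolding E_def mem_Collect_eq
      by (intro rec_pred_disj rec_pred_less rec_fun_add rec_fun_mult rec_fun_num_words_hit M_rec
          rec_fun_const rec_fun_power rec_fun_nth) auto
    fix k and y z :: "nat \<Rightarrow> 'a"
    assume "y \<in> E k" and eq: "\<And>t. t < M k + k \<Longrightarrow> y t = z t"
    moreover have "num_words_hit k (M k) i y = num_words_hit k (M k) i z"
      by (rule num_words_hit_cong) (simp add: eq)
    ultimately show "z \<in> E k"
      by (simp add: E_def)
  qed simp
  then show ?thesis
  proof (rule eventually_mono)
    fix k assume "x \<notin> E k"
    then have "\<bar>real T * Z lam i k x - real T * pois i lam\<bar> \<le> 3"
      unfolding E_iff Z_eq_num_words_hit[OF lam] M_floor using s by linarith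
    then have "real T * \<bar>Z lam i k x - pois i lam\<bar> \<le> 3"
      by (simp only: scale)
    then show "\<bar>Z lam i k x - pois i lam\<bar> \<le> 3 / real T"
      using T by (simp add: le_divide_eq mult.commute)
  qed
qed

lemma pois_lipschitz:
  assumes "0 \<le> s" "0 \<le> t"
  shows "\<bar>pois i s - pois i t\<bar> \<le> \<bar>s - t\<bar>"
  using field_differentiable_bound[of "{0..}" "pois i" "pois_deriv i" 1 s t] assms abs_pois_deriv_le
  by (auto intro: has_field_derivative_at_within DERIV_pois)

text \<open>
  Each position changes the number of words with \<open>i\<close> occurrences by at most \<open>1\<close>, and there are at most
  \<open>\<bar>lam - lam'\<bar> b ^ k + 1\<close> positions between the two ranges.
\<close>

lemma Z_lipschitz:
  fixes x :: "nat \<Rightarrow> 'a::finite"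
  assumes "0 \<le> lam" "0 \<le> lam'"
  shows "\<bar>Z lam i k x - Z lam' i k x\<bar> \<le> \<bar>lam - lam'\<bar> + 1 / real CARD('a) ^ k"
  using assms
proof (induction lam lam' rule: linorder_wlog)
  case (le lam lam')
  define B where "B = real CARD('a) ^ k"
  have B: "0 < B" by (simp add: B_def)
  define m m' where "m = nat \<lfloor>lam * B\<rfloor>" and "m' = nat \<lfloor>lam' * B\<rfloor>"
  have mm': "m \<le> m'"
    unfolding m_def m'_def using le B by (intro nat_mono floor_mono mult_right_mono) auto
  have "0 \<le> lam * B" "0 \<le> lam' * B"
    using le B by simp_all
  then have "real m' - real m \<le> lam' * B - lam * B + 1"
    unfolding m_def m'_def by linarith
  moreover have "\<bar>real (num_words_hit k m' i x) - real (num_words_hit k m i x)\<bar> \<le> real m' - real m"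
    using abs_num_words_hit_diff_le[OF mm', of k i x] mm' by simp
  ultimately have "\<bar>real (num_words_hit k m' i x) - real (num_words_hit k m i x)\<bar> / B \<le> (lam' * B - lam * B + 1) / B"
    using B by (intro divide_right_mono) auto
  also have "\<dots> = \<bar>lam - lam'\<bar> + 1 / B"
    using le B by (simp add: add_divide_distrib diff_divide_distrib)
  also have "\<bar>real (num_words_hit k m' i x) - real (num_words_hit k m i x)\<bar> / B = \<bar>Z lam i k x - Z lam' i k x\<bar>"
    using le B unfolding m_def m'_def B_def
    by (simp add: Z_eq_num_words_hit abs_minus_commute flip: diff_divide_distrib)
  finally show ?case
    by (simp add: B_def)
next
  case (sym lam lam')
  then show ?case
    by (simp add: abs_minus_commute)
qed

theorem theorem3:
  fixes x :: "nat \<Rightarrow> 'a::finite"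
  assumes "CARD('a) \<ge> 2"
    and "martin_loef_random x"
  shows "poisson_generic x"
  unfolding poisson_generic_def poisson_generic_for_def
proof (intro allI impI)
  fix lam :: real and i
  assume lam: "0 < lam"
  have "(\<lambda>k. Z lam i k x) \<longlonglongrightarrow> pois i lam"
  proof (rule tendstoI)
    fix \<epsilon> :: real assume "0 < \<epsilon>"
    then obtain N where N: "inverse (real (Suc N)) < \<epsilon> / 6"
      using reals_Archimedean[of "\<epsilon> / 6"] by auto
    \<comment> \<open>Replacing \<open>lam\<close> by \<open>\<rho> = p / q\<close> costs \<open>1 / q\<close> in each of \<open>Z\<close> and \<open>pois\<close>, and the deviation at \<open>\<rho>\<close>
      is eventually at most \<open>3 / q\<close>. The sixth part of \<open>\<epsilon>\<close> that remains is for \<open>b ^ (- k)\<close>.\<close>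
    define q where "q = Suc N"
    define p where "p = nat \<lfloor>lam * real q\<rfloor>"
    define \<rho> where "\<rho> = real p / real q"
    have q: "0 < q" "1 / real q < \<epsilon> / 6"
      using N by (simp_all add: q_def inverse_eq_divide)
    have \<rho>: "0 \<le> \<rho>" "\<bar>lam - \<rho>\<bar> \<le> 1 / real q"
    proof -
      have "0 \<le> lam * real q"
        using lam by simp
      then have "\<bar>lam * real q - real p\<bar> \<le> 1"
        unfolding p_def by linarith
      then have "\<bar>lam * real q - real p\<bar> / real q \<le> 1 / real q"
        by (intro divide_right_mono) auto
      also have "\<bar>lam * real q - real p\<bar> / real q = \<bar>(lam * real q - real p) / real q\<bar>"
        by simp
      also have "(lam * real q - real p) / real q = lam - \<rho>"
        using q(1) by (simp add: \<rho>_def diff_divide_distrib)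
      finally show "\<bar>lam - \<rho>\<bar> \<le> 1 / real q" .
    qed (simp add: \<rho>_def)
    have "(\<lambda>k. (1 / real CARD('a)) ^ k) \<longlonglongrightarrow> 0"
      using assms(1) by (intro LIMSEQ_power_zero) simp
    then have "\<forall>\<^sub>F k in sequentially. (1 / real CARD('a)) ^ k < \<epsilon> / 6"
      by (rule order_tendstoD) (use \<open>0 < \<epsilon>\<close> in simp)
    moreover have "\<forall>\<^sub>F k in sequentially. \<bar>Z \<rho> i k x - pois i \<rho>\<bar> \<le> 3 / real q"
      unfolding \<rho>_def by (rule martin_loef_random_near_pois[OF assms q(1)])
    ultimately show "\<forall>\<^sub>F k in sequentially. dist (Z lam i k x) (pois i lam) < \<epsilon>"
    proof eventually_elim
      case (elim k)
      have "\<bar>Z lam i k x - Z \<rho> i k x\<bar> \<le> 1 / real q + (1 / real CARD('a)) ^ k"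
        using Z_lipschitz[of lam \<rho> i k x] \<rho> lam by (simp add: power_one_over)
      moreover have "\<bar>pois i \<rho> - pois i lam\<bar> \<le> 1 / real q"
        using pois_lipschitz[of \<rho> lam i] \<rho> lam by linarith
      moreover have "3 / real q = 3 * (1 / real q)"
        by simp
      ultimately show ?case
        using elim q(2) unfolding dist_real_def by linarith
    qed
  qed
  then show "(\<lambda>k. Z lam i k x) \<longlonglongrightarrow> exp (- lam) * lam ^ i / fact i"
    by (simp add: pois_def)
qed

end
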